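(* There is a universal constant $C$ such that for all integers $d\ge1$, $k\ge1$: $\mathbb{D}_{\mathrm{onl}}(\mathcal{H}_{k,d};\ell_\cap)\le Ck^2\log^4(edk)$. Consequently (via the characterization of the minimax realizable cumulative loss by $\mathbb D_{\mathrm{onl}}$), there is a deterministic online learner whose cumulative squared loss $\sum_t(\hat y_t-y_t)^2$ on every sequence realizable by $\mathcal{H}_{k,d}$ is $O(k^2\log^4(edk))$.
   Context: $\mathcal{X}=\{x\in[-1,1]^d:\|x\|_2\le1\}$, $\mathrm{clip}(z)=\max\{-1,\min\{1,z\}\}$, $\mathrm{ReLU}(z)=\max\{0,z\}$. $\mathcal{H}_{k,d}=\{x\mapsto\mathrm{clip}(\sum_{j=1}^ka_j\mathrm{ReLU}(w^j\cdot x)): a_j\in[-1,1],\ \|w^j\|_2\le1\}$. Clipped squared loss $\ell_\cap(\hat y,y)=\min\{1,(\hat y-y)^2/4\}$. Scaled Littlestone tree of depth $D\le\infty$: internal nodes $u\in\{0,1\}^{<D}$ labeled $x_u\in\mathcal X$, edges labeled $s_{u,0},s_{u,1}\in\mathbb R$, gap $\gamma_u=\ell_\cap(s_{u,0},s_{u,1})$; realizable by a class $\mathcal H$ if for every branch $b$ and finite $n\le D$ some $h\in\mathcal{H}$ has $h(x_{b_{\le t}})=s_{b_{\le t},b_{t+1}}$ for $t<n$ ($b_{\le t}$ the length-$t$ prefix). $\mathbb{D}_{\mathrm{onl}}(\mathcal{H};\ell_\cap)=\sup_{\mathcal T}\inf_b\sum_t\gamma_{b_{\le t}}$ over realizable trees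 and their branches. *)

theory Defs
  imports "HOL-Analysis.Analysis" "HOL-Library.Extended_Nat" "HOL-Library.Extended_Nonnegative_Real"
begin

definition domX :: "nat \<Rightarrow> (nat \<Rightarrow> real) set" where
  "domX d = {x. (\<forall>i<d. \<bar>x i\<bar> \<le> 1) \<and> (\<forall>i\<ge>d. x i = 0) \<and> (\<Sum>i<d. (x i)\<^sup>2) \<le> 1}"

definition clip :: "real \<Rightarrow> real" where
  "clip z = max (-1) (min 1 z)"

definition relu :: "real \<Rightarrow> real" where
  "relu z = max 0 z"

definition Hkd :: "nat \<Rightarrow> nat \<Rightarrow> ((nat \<Rightarrow> real) \<Rightarrow> real) set" where
  "Hkd k d = {h. \<exists>(a :: nat \<Rightarrow> real) (w :: nat \<Rightarrow> nat \<Rightarrow> real).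
       (\<forall>j<k. \<bar>a j\<bar> \<le> 1 \<and> (\<Sum>i<d. (w j i)\<^sup>2) \<le> 1) \<and>
       (\<forall>x. h x = clip (\<Sum>j<k. a j * relu (\<Sum>i<d. w j i * x i)))}"

definition loss_cap :: "real \<Rightarrow> real \<Rightarrow> real" where
  "loss_cap yh y = min 1 ((yh - y)\<^sup>2 / 4)"

definition pref :: "(nat \<Rightarrow> bool) \<Rightarrow> nat \<Rightarrow> bool list" where
  "pref b t = map b [0..<t]"

text \<open>A scaled Littlestone tree of depth D (D may be infinite): node labels xt u
  for nodes u with length u < D, edge labels st u False / st u True.\<close>
definition realizable_tree ::
  "((nat \<Rightarrow> real) \<Rightarrow> real) set \<Rightarrow> (nat \<Rightarrow> real) set \<Rightarrow> enat \<Rightarrow>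
   (bool list \<Rightarrow> (nat \<Rightarrow> real)) \<Rightarrow> (bool list \<Rightarrow> bool \<Rightarrow> real) \<Rightarrow> bool" where
  "realizable_tree H X D xt st \<longleftrightarrow>
     (\<forall>u. enat (length u) < D \<longrightarrow> xt u \<in> X) \<and>
     (\<forall>b. \<forall>n::nat. enat n \<le> D \<longrightarrow>
        (\<exists>h\<in>H. \<forall>t<n. h (xt (pref b t)) = st (pref b t) (b t)))"

definition gap :: "(bool list \<Rightarrow> bool \<Rightarrow> real) \<Rightarrow> bool list \<Rightarrow> real" where
  "gap st u = loss_cap (st u False) (st u True)"

definition branch_gain :: "enat \<Rightarrow> (bool list \<Rightarrow> bool \<Rightarrow> real) \<Rightarrow> (nat \<Rightarrow> bool) \<Rightarrow> ennreal" where
  "branch_gain D st b = (\<Sum>t. if enat t < D then ennreal (gap st (pref b t)) else 0)"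

definition D_onl :: "((nat \<Rightarrow> real) \<Rightarrow> real) set \<Rightarrow> (nat \<Rightarrow> real) set \<Rightarrow> ennreal" where
  "D_onl H X = (SUP T \<in> {(D, xt, st). realizable_tree H X D xt st}.
       (case T of (D, xt, st) \<Rightarrow> (INF b. branch_gain D st b)))"

definition realizable_seq ::
  "((nat \<Rightarrow> real) \<Rightarrow> real) set \<Rightarrow> (nat \<Rightarrow> real) set \<Rightarrow> ((nat \<Rightarrow> real) \<times> real) list \<Rightarrow> bool" where
  "realizable_seq H X zs \<longleftrightarrow> (\<forall>z\<in>set zs. fst z \<in> X) \<and> (\<exists>h\<in>H. \<forall>z\<in>set zs. h (fst z) = snd z)"

definition cum_sq_loss ::
  "(((nat \<Rightarrow> real) \<times> real) list \<Rightarrow> (nat \<Rightarrow> real) \<Rightarrow> real) \<Rightarrow> ((nat \<Rightarrow> real) \<times> real) list \<Rightarrow> real" where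
  "cum_sq_loss L zs = (\<Sum>t<length zs. (L (take t zs) (fst (zs ! t)) - snd (zs ! t))\<^sup>2)"

end

theory Submission
  imports Defs
begin

text \<open>
  For a version space \<open>V\<close> let \<open>n\<^sub>i(V)\<close> be the largest depth of a complete tree with label gaps at least
  \<open>2\<^sup>-\<^sup>i\<close> all of whose branches are realized in \<open>V\<close>. A learner can predict so that its squared error is
  at most four times the decrease of the potential \<open>\<Sum>\<^sub>i 4\<^sup>-\<^sup>i n\<^sub>i(V)\<close>, and a learner with cumulative loss
  \<open>B\<close> forces \<open>D_onl \<le> B\<close>, so it suffices to bound the potential of the whole class.

  At scales above \<open>1 / (d k)\<^sup>2\<close> the dimension is \<open>O(4\<^sup>i k\<^sup>2 log\<^sup>3 (e d k))\<close>: linear functions have a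
  sequential cover of size \<open>(2 n + 1)\<^bsup>1/a\<^sup>2\<^esup>\<close> at scale \<open>a\<close> formed by perceptrons, the ReLU is
  1-Lipschitz, and chaining over the dyadic scales bounds the correlation of a single ReLU with the signs
  of an adversarially chosen branch. There are \<open>O(log (e d k))\<close> such scales; at the finer ones a grid
  in parameter space gives \<open>n\<^sub>i = O((d k)\<^sup>2 2\<^sup>i)\<close>, which contributes only a constant.
\<close>

section \<open>Scale-sensitive dimensions and learners\<close>

text \<open>The recursion runs over version spaces rather than explicit trees: following an edge
  keeps exactly the functions taking its label, so a nonempty set at depth 0 is a realized branch.
  \<open>e\<close> is a distance between labels, not a loss.\<close>

fun shatters :: "'a set \<Rightarrow> real \<Rightarrow> nat \<Rightarrow> ('a \<Rightarrow> real) set \<Rightarrow> bool" where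
  "shatters X e 0 V \<longleftrightarrow> V \<noteq> {}"
| "shatters X e (Suc n) V \<longleftrightarrow>
     (\<exists>x\<in>X. \<exists>s s'. s + e \<le> s' \<and> shatters X e n {h\<in>V. h x = s} \<and> shatters X e n {h\<in>V. h x = s'})"

lemma shatters_mono: "shatters X e n V \<Longrightarrow> V \<subseteq> W \<Longrightarrow> shatters X e n W"
proof (induction n arbitrary: V W)
  case 0
  then show ?case by auto
next
  case (Suc n)
  then obtain x s s' where x: "x \<in> X" "s + e \<le> s'"
    "shatters X e n {h\<in>V. h x = s}" "shatters X e n {h\<in>V. h x = s'}" by auto
  have "shatters X e n {h\<in>W. h x = s}" "shatters X e n {h\<in>W. h x = s'}"
    using Suc.IH[OF x(3), of "{h\<in>W. h x = s}"] Suc.IH[OF x(4), of "{h\<in>W. h x = s'}"] Suc.prems(2)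
    by auto
  with x show ?case by auto
qed

lemma shatters_Suc_imp: "shatters X e (Suc n) V \<Longrightarrow> shatters X e n V"
  by (auto intro: shatters_mono)

lemma shatters_nonempty: "shatters X e n V \<Longrightarrow> V \<noteq> {}"
  by (induction n arbitrary: V) fastforce+

lemma shatters_le: "shatters X e n V \<Longrightarrow> m \<le> n \<Longrightarrow> shatters X e m V"
  by (induction n) (auto simp: le_Suc_eq dest: shatters_Suc_imp simp del: shatters.simps)

text \<open>The supremum is meaningful only for bounded depths, so the lemmas below carry a bound
  \<open>B\<close> for an ambient class \<open>H\<close>. An empty version space gets 0.\<close>

definition sdim :: "'a set \<Rightarrow> real \<Rightarrow> ('a \<Rightarrow> real) set \<Rightarrow> nat" where
  "sdim X e V = Sup {n. shatters X e n V}"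

lemma sdim_bounds:
  assumes "V \<subseteq> H" "\<And>n. shatters X e n H \<Longrightarrow> n \<le> B"
  shows "shatters X e n V \<Longrightarrow> n \<le> sdim X e V"
    and "V \<noteq> {} \<Longrightarrow> shatters X e (sdim X e V) V"
    and "sdim X e V \<le> B"
proof -
  have sub: "{n. shatters X e n V} \<subseteq> {..B}"
    using assms shatters_mono by blast
  then have fin: "finite {n. shatters X e n V}" by (rule finite_subset) simp
  show "shatters X e n V \<Longrightarrow> n \<le> sdim X e V"
    unfolding sdim_def using fin by (intro cSup_upper) (auto intro: bdd_above_finite)
  show *: "shatters X e (sdim X e V) V" if "V \<noteq> {}"
  proof -
    have "0 \<in> {n. shatters X e n V}" using that by simp
    then have "sdim X e V \<in> {n. shatters X e n V}"
      unfolding sdim_def using fin by (metis Max_in Sup_nat_def empty_iff)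
    then show ?thesis by simp
  qed
  show "sdim X e V \<le> B"
  proof (cases "V = {}")
    case True
    then have "{n. shatters X e n V} = {}" using shatters_nonempty by blast
    then show ?thesis by (simp add: sdim_def)
  qed (use * sub in auto)
qed

text \<open>If both restrictions kept the dimension of \<open>V\<close>, their trees could be joined
  under a root at \<open>x\<close> into a deeper one.\<close>

lemma sdim_restrict_less:
  assumes "V \<subseteq> H" "\<And>n. shatters X e n H \<Longrightarrow> n \<le> B" "x \<in> X" "y + e \<le> y'"
    "{h\<in>V. h x = y} \<noteq> {}" "{h\<in>V. h x = y'} \<noteq> {}"
  shows "sdim X e {h\<in>V. h x = y} < sdim X e V \<or> sdim X e {h\<in>V. h x = y'} < sdim X e V"
proof (rule ccontr)
  assume *: "\<not> ?thesis"
  have sub: "{h\<in>V. h x = c} \<subseteq> H" for c using assms(1) by auto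
  have "shatters X e (sdim X e V) {h\<in>V. h x = c}" if "c = y \<or> c = y'" for c
  proof -
    have "shatters X e (sdim X e {h\<in>V. h x = c}) {h\<in>V. h x = c}"
      by (rule sdim_bounds(2)[OF sub assms(2)]) (use assms(5,6) that in auto)
    moreover have "sdim X e V \<le> sdim X e {h\<in>V. h x = c}" using * that by auto
    ultimately show ?thesis by (rule shatters_le)
  qed
  then have "shatters X e (Suc (sdim X e V)) V"
    using assms(3,4) by auto
  then show False using sdim_bounds(1)[OF assms(1,2)] by fastforce
qed

lemma sdim_mono:
  assumes "V \<subseteq> W" "W \<subseteq> H" "\<And>n. shatters X e n H \<Longrightarrow> n \<le> B"
  shows "sdim X e V \<le> sdim X e W"
proof (cases "V = {}")
  case True
  then have "{n. shatters X e n V} = {}" using shatters_nonempty by blast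
  then show ?thesis by (simp add: sdim_def)
next
  case False
  have "shatters X e (sdim X e V) V"
    using sdim_bounds(2)[of V H, OF _ assms(3)] assms(1,2) False by auto
  then show ?thesis
    using sdim_bounds(1)[OF assms(2,3)] shatters_mono[OF _ assms(1)] by blast
qed

text \<open>One-dimensional Helly: the intervals with centre \<open>y\<close> and radius \<open>2 * sqrt (D y)\<close> meet pairwise,
  hence have a common point.\<close>

lemma common_point:
  fixes D :: "real \<Rightarrow> real"
  assumes "\<And>y y'. y \<in> Y \<Longrightarrow> y' \<in> Y \<Longrightarrow> (y - y')\<^sup>2 \<le> 4 * (D y + D y')"
  shows "\<exists>p. \<forall>y\<in>Y. (p - y)\<^sup>2 \<le> 4 * D y"
proof (cases "Y = {}")
  case False
  define r where "r y = 2 * sqrt (D y)" for y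
  \<comment> \<open>Each left endpoint lies below every right endpoint, so the supremum of the left
    endpoints lies in all intervals.\<close>
  define p where "p = (SUP y\<in>Y. y - r y)"
  have nn: "D y \<ge> 0" if "y \<in> Y" for y using assms[OF that that] by simp
  have meet: "y - r y \<le> y' + r y'" if "y \<in> Y" "y' \<in> Y" for y y'
  proof -
    have "(y - y')\<^sup>2 \<le> (r y + r y')\<^sup>2"
      using assms[OF that] nn[OF that(1)] nn[OF that(2)]
      by (simp add: r_def power2_sum power_mult_distrib add_increasing2)
    moreover have "r y + r y' \<ge> 0" using nn that by (simp add: r_def)
    ultimately have "y - y' \<le> r y + r y'" by (metis abs_le_square_iff abs_of_nonneg abs_ge_self order_trans)
    then show ?thesis by simp
  qed
  have "(p - y)\<^sup>2 \<le> 4 * D y" if y: "y \<in> Y" for y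
  proof -
    have bdd: "bdd_above ((\<lambda>y. y - r y) ` Y)"
      using meet[OF _ y] by (auto intro!: bdd_aboveI)
    have "y - r y \<le> p" unfolding p_def by (rule cSUP_upper[OF y bdd])
    moreover have "p \<le> y + r y" unfolding p_def using False meet[OF _ y] by (intro cSUP_least) auto
    ultimately have "\<bar>p - y\<bar> \<le> r y" by simp
    then have "(p - y)\<^sup>2 \<le> (r y)\<^sup>2" by (metis abs_ge_zero power2_abs power_mono)
    then show ?thesis using nn[OF y] by (simp add: r_def power_mult_distrib)
  qed
  then show ?thesis by blast
qed auto

section \<open>Dyadic scales and potential-based learners\<close>

lemma square_two_power: "((2::real) ^ i)\<^sup>2 = 4 ^ i"
  by (simp add: power_mult[symmetric] mult.commute[of i] power_mult)

lemma dyadic_scale: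
  fixes e :: real assumes "0 < e" "e \<le> 2"
  shows "\<exists>i. 1 / 2 ^ i \<le> e \<and> e \<le> 2 * (1 / 2 ^ i)"
proof -
  have "\<exists>i. 1 / 2 ^ i \<le> e"
    using real_arch_pow_inv[OF assms(1), of "1/2"] by (auto simp: power_one_over intro: less_imp_le)
  then obtain i where i: "1 / 2 ^ i \<le> e" "\<And>j. j < i \<Longrightarrow> \<not> 1 / 2 ^ j \<le> e"
    using exists_least_iff[of "\<lambda>i. 1 / 2 ^ i \<le> e"] by blast
  show ?thesis
  proof (cases i)
    case 0
    then show ?thesis using assms i(1) by (intro exI[of _ 0]) auto
  next
    case (Suc j)
    then have "e < 1 / 2 ^ j" using i(2)[of j] by simp
    then show ?thesis using i(1) Suc by (intro exI[of _ i]) simp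
  qed
qed

definition vspace :: "('a \<Rightarrow> real) set \<Rightarrow> ('a \<times> real) list \<Rightarrow> ('a \<Rightarrow> real) set" where
  "vspace H zs = {h\<in>H. \<forall>z\<in>set zs. h (fst z) = snd z}"

lemma vspace_snoc: "vspace H (zs @ [z]) = {h\<in>vspace H zs. h (fst z) = snd z}"
  by (auto simp: vspace_def)

text \<open>The hypothesis is the pairwise condition of \<open>common_point\<close> with
  \<open>D y\<close> the potential lost when label \<open>y\<close> is revealed. A common point is a
  prediction whose squared error is paid for by that loss, and the losses telescope.\<close>

lemma learner_from_potential:
  fixes pot :: "((nat \<Rightarrow> real) \<Rightarrow> real) set \<Rightarrow> real"
  assumes pot: "\<And>V x y y'. V \<subseteq> H \<Longrightarrow> x \<in> X \<Longrightarrow> {h\<in>V. h x = y} \<noteq> {} \<Longrightarrow> {h\<in>V. h x = y'} \<noteq> {} \<Longrightarrow>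
      (y - y')\<^sup>2 \<le> 4 * ((pot V - pot {h\<in>V. h x = y}) + (pot V - pot {h\<in>V. h x = y'}))"
    and nonneg: "\<And>V. V \<subseteq> H \<Longrightarrow> 0 \<le> pot V"
  shows "\<exists>L. \<forall>zs. realizable_seq H X zs \<longrightarrow> cum_sq_loss L zs \<le> 4 * pot H"
proof -
  define good where "good V x p \<longleftrightarrow>
    (\<forall>y\<in>{y. {h\<in>V. h x = y} \<noteq> {}}. (p - y)\<^sup>2 \<le> 4 * (pot V - pot {h\<in>V. h x = y}))" for V x p
  define L where "L zs x = (SOME p. good (vspace H zs) x p)" for zs x
  have L: "good (vspace H zs) x (L zs x)" if "x \<in> X" for zs x
  proof -
    have "vspace H zs \<subseteq> H" by (auto simp: vspace_def)
    then have "\<exists>p. good (vspace H zs) x p"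
      unfolding good_def by (intro common_point) (use pot that in auto)
    then show ?thesis unfolding L_def by (rule someI_ex)
  qed
  have "cum_sq_loss L zs \<le> 4 * (pot H - pot (vspace H zs))" if "realizable_seq H X zs" for zs
    using that
  proof (induction zs rule: rev_induct)
    case Nil
    then show ?case by (simp add: cum_sq_loss_def vspace_def)
  next
    case (snoc z zs)
    obtain x y where z: "z = (x, y)" by force
    from snoc.prems have x: "x \<in> X" and re: "realizable_seq H X zs"
      and ne: "{h\<in>vspace H zs. h x = y} \<noteq> {}"
      by (auto simp: realizable_seq_def vspace_def z)
    have "cum_sq_loss L (zs @ [z]) = cum_sq_loss L zs + (L zs x - y)\<^sup>2"
      by (simp add: cum_sq_loss_def nth_append z)
    also have "(L zs x - y)\<^sup>2 \<le> 4 * (pot (vspace H zs) - pot {h\<in>vspace H zs. h x = y})"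
      using L[OF x, of zs] ne by (auto simp: good_def)
    finally show ?case using snoc.IH[OF re] by (simp add: vspace_snoc z)
  qed
  moreover have "pot (vspace H zs) \<ge> 0" for zs by (rule nonneg) (auto simp: vspace_def)
  ultimately have "cum_sq_loss L zs \<le> 4 * pot H" if "realizable_seq H X zs" for zs
    using that by (meson order_trans mult_left_mono diff_le_eq le_add_same_cancel1 zero_le_numeral)
  then show ?thesis by blast
qed

text \<open>Two labels at distance \<open>e\<close> cannot both keep the dimension at the dyadic scale just below \<open>e\<close>, so
  the sum of \<open>\<epsilon>\<^sup>2\<close> times the dimension over all dyadic \<open>\<epsilon>\<close> is a valid potential.\<close>

lemma learner_from_dimensions:
  fixes H :: "((nat \<Rightarrow> real) \<Rightarrow> real) set"
  assumes bnd: "\<And>h x. h \<in> H \<Longrightarrow> x \<in> X \<Longrightarrow> \<bar>h x\<bar> \<le> 1"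
    and dim: "\<And>i n. shatters X (1 / 2 ^ i) n H \<Longrightarrow> real n / 4 ^ i \<le> G i"
    and G: "summable G" "\<And>i. 0 \<le> G i"
  shows "\<exists>L. \<forall>zs. realizable_seq H X zs \<longrightarrow> cum_sq_loss L zs \<le> 4 * suminf G"
proof -
  define B where "B i = nat \<lfloor>4 ^ i * G i\<rfloor>" for i
  have B: "n \<le> B i" if "shatters X (1 / 2 ^ i) n H" for i n
    using dim[OF that] by (simp add: B_def field_simps le_nat_floor)
  define t where "t V i = real (sdim X (1 / 2 ^ i) V) / 4 ^ i" for V i
  define pot where "pot V = suminf (t V)" for V
  have tG: "t V i \<le> G i" if "V \<subseteq> H" for V i
  proof -
    have "real (sdim X (1 / 2 ^ i) V) \<le> real (B i)" using sdim_bounds(3)[OF that B] by simp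
    also have "\<dots> \<le> 4 ^ i * G i" using G(2) by (simp add: B_def)
    finally show ?thesis by (simp add: t_def field_simps)
  qed
  have t0: "0 \<le> t V i" for V i by (simp add: t_def)
  have st: "summable (t V)" if "V \<subseteq> H" for V
    using tG[OF that] t0 by (intro summable_comparison_test'[OF G(1), of 0]) auto
  have tm: "t V i \<le> t W i" if "V \<subseteq> W" "W \<subseteq> H" for V W i
    using sdim_mono[OF that B] by (auto simp: t_def divide_right_mono)
  \<comment> \<open>One scale suffices for a lower bound because restriction cannot increase the
    term of any other scale.\<close>
  have drop: "pot V - pot W \<ge> (if sdim X (1 / 2 ^ i) W < sdim X (1 / 2 ^ i) V then 1 / 4 ^ i else 0)"
    if VW: "W \<subseteq> V" "V \<subseteq> H" for V W i
  proof -
    have W: "W \<subseteq> H" using VW by auto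
    have "(if sdim X (1 / 2 ^ i) W < sdim X (1 / 2 ^ i) V then 1 / 4 ^ i else 0) \<le> t V i - t W i"
      using tm[OF VW, of i] by (auto simp: t_def diff_divide_distrib[symmetric] divide_right_mono) (simp add: diff_divide_distrib)
    also have "\<dots> \<le> (\<Sum>i. t V i - t W i)"
      using sum_le_suminf[OF summable_diff[OF st[OF VW(2)] st[OF W]], of "{i}"] tm[OF VW] by auto
    also have "\<dots> = pot V - pot W"
      unfolding pot_def using suminf_diff[OF st[OF VW(2)] st[OF W]] by simp
    finally show ?thesis .
  qed
  have key: "(y - y')\<^sup>2 \<le> 4 * ((pot V - pot {h\<in>V. h x = y}) + (pot V - pot {h\<in>V. h x = y'}))"
    if "V \<subseteq> H" "x \<in> X" "{h\<in>V. h x = y} \<noteq> {}" "{h\<in>V. h x = y'} \<noteq> {}" "y < y'" for V x y y'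
  proof -
    have "\<bar>y\<bar> \<le> 1" "\<bar>y'\<bar> \<le> 1" using that bnd by auto
    then have "y' - y \<le> 2" by linarith
    then obtain i where i: "1 / 2 ^ i \<le> y' - y" "y' - y \<le> 2 * (1 / 2 ^ i)"
      using dyadic_scale[of "y' - y"] \<open>y < y'\<close> by (metis diff_gt_0_iff_gt)
    have "(y' - y)\<^sup>2 \<le> (2 * (1 / 2 ^ i))\<^sup>2" using i(2) \<open>y < y'\<close> by (intro power_mono) auto
    also have "\<dots> = 4 * (1 / 4 ^ i)"
      by (simp add: power_mult_distrib power_divide square_two_power)
    finally have "(y - y')\<^sup>2 \<le> 4 * (1 / 4 ^ i)" by (simp add: power2_commute)
    moreover have "{h\<in>V. h x = y} \<subseteq> V" "{h\<in>V. h x = y'} \<subseteq> V" by auto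
    note d = drop[OF this(1) that(1), of i] drop[OF this(2) that(1), of i]
    have "1 / 4 ^ i \<le> (pot V - pot {h\<in>V. h x = y}) + (pot V - pot {h\<in>V. h x = y'})"
    proof -
      have "0 \<le> (1::real) / 4 ^ i" by simp
      then show ?thesis
          using d sdim_restrict_less[OF that(1) B[of i] that(2) _ that(3,4)] i(1)
        by (smt (verit, best))
    qed
    ultimately show ?thesis by (meson mult_left_mono order_trans zero_le_numeral)
  qed
  have "\<exists>L. \<forall>zs. realizable_seq H X zs \<longrightarrow> cum_sq_loss L zs \<le> 4 * pot H"
  proof (rule learner_from_potential)
    fix V x y y'
    assume a: "V \<subseteq> H" "x \<in> X" "{h\<in>V. h x = y} \<noteq> {}" "{h\<in>V. h x = y'} \<noteq> {}"
    consider "y < y'" | "y' < y" | "y = y'" by linarith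
    then show "(y - y')\<^sup>2 \<le> 4 * ((pot V - pot {h\<in>V. h x = y}) + (pot V - pot {h\<in>V. h x = y'}))"
    proof cases
      case 1 then show ?thesis using key a by blast
    next
      case 2 then show ?thesis using key[OF a(1,2,4,3)] by (simp add: power2_commute add.commute)
    next
      case 3
      have "{h\<in>V. h x = y} \<subseteq> V" by auto
      from drop[OF this a(1), of 0] have "0 \<le> pot V - pot {h\<in>V. h x = y}"
        by (auto split: if_splits)
      then show ?thesis by (simp add: 3)
    qed
  next
    fix V assume "V \<subseteq> H" then show "0 \<le> pot V"
      unfolding pot_def using st t0 by (simp add: suminf_nonneg)
  qed
  moreover have "pot H \<le> suminf G"
    unfolding pot_def using tG st G by (intro suminf_le) auto
  ultimately show ?thesis by (meson mult_left_mono order_trans zero_le_numeral)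
qed

text \<open>Against any prediction the adversary descends to the child whose label is farther away, which
  costs the learner at least the gap of the node.\<close>

lemma D_onl_le_learner_loss:
  assumes L: "\<And>zs. realizable_seq H X zs \<Longrightarrow> cum_sq_loss L zs \<le> B"
  shows "D_onl H X \<le> ennreal B"
  unfolding D_onl_def
proof (rule SUP_least, clarsimp)
  fix D xt st assume T: "realizable_tree H X D xt st"
  \<comment> \<open>\<open>ans u\<close> is the history at \<open>u\<close>: the labelled examples
    on the path, without the one at \<open>u\<close> itself.\<close>
  define ans where "ans u = map (\<lambda>t. (xt (take t u), st (take t u) (u ! t))) [0..<length u]" for u
  define far where "far u \<longleftrightarrow> (L (ans u) (xt u) - st u False)\<^sup>2 \<le> (L (ans u) (xt u) - st u True)\<^sup>2" for u
  \<comment> \<open>Each move depends on the whole history, so the path is built by recursion on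
    nodes and its branch \<open>b\<close> is read off afterwards.\<close>
  define node where "node = rec_nat [] (\<lambda>_ u. u @ [far u])"
  define b where "b t = far (node t)" for t
  have pref: "pref b t = node t" for t
    by (induction t) (auto simp: pref_def node_def b_def)
  have take_pref: "take s (pref b t) = pref b s" if "s \<le> t" for s t
    using that by (simp add: pref_def take_map)
  have loss: "gap st u \<le> (L (ans u) (xt u) - st u (far u))\<^sup>2" for u
  proof -
    \<comment> \<open>The farther label carries at least a quarter of the squared label distance,
      which matches the factor 1/4 in \<open>loss_cap\<close>.\<close>
    have "(st u False - st u True)\<^sup>2 \<le> 2 * (L (ans u) (xt u) - st u False)\<^sup>2 + 2 * (L (ans u) (xt u) - st u True)\<^sup>2"
      using sum_squares_bound[of "st u False - L (ans u) (xt u)" "L (ans u) (xt u) - st u True"]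
      by (simp add: power2_eq_square algebra_simps)
    then have "(st u False - st u True)\<^sup>2 / 4 \<le> (L (ans u) (xt u) - st u (far u))\<^sup>2"
      by (cases "far u") (auto simp: far_def)
    then show ?thesis unfolding gap_def loss_cap_def by linarith
  qed
  have part: "(\<Sum>t<n. gap st (pref b t)) \<le> B" if n: "enat n \<le> D" for n
  proof -
    have ans: "ans (pref b n) = map (\<lambda>t. (xt (pref b t), st (pref b t) (b t))) [0..<n]" for n
      by (auto simp: ans_def pref_def take_map)
    from T n obtain h where "h \<in> H" "\<forall>t<n. h (xt (pref b t)) = st (pref b t) (b t)"
      unfolding realizable_tree_def by blast
    moreover have "xt (pref b t) \<in> X" if "t < n" for t
    proof -
      have "enat (length (pref b t)) < D" using that n
        by (simp add: pref_def) (meson enat_ord_simps(2) order_less_le_trans)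
      then show ?thesis using T unfolding realizable_tree_def by blast
    qed
    ultimately have "realizable_seq H X (ans (pref b n))"
      unfolding realizable_seq_def ans by (auto intro!: bexI[of _ h])
    from L[OF this] have "(\<Sum>t<n. (L (take t (ans (pref b n))) (xt (pref b t)) - st (pref b t) (b t))\<^sup>2) \<le> B"
      unfolding cum_sq_loss_def by (simp add: ans)
    moreover have "take t (ans (pref b n)) = ans (pref b t)" if "t < n" for t
      using that by (simp add: ans take_map)
    ultimately have "(\<Sum>t<n. (L (ans (pref b t)) (xt (pref b t)) - st (pref b t) (b t))\<^sup>2) \<le> B"
      by simp
    moreover have "b t = far (pref b t)" for t by (simp add: pref b_def)
    ultimately show ?thesis
      using sum_mono[of "{..<n}" "\<lambda>t. gap st (pref b t)"] loss by (smt (verit, best))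
  qed
  have gap0: "0 \<le> gap st u" for u by (simp add: gap_def loss_cap_def)
  have "branch_gain D st b \<le> ennreal B"
    unfolding branch_gain_def
  proof (rule suminf_le_const)
    fix N
    \<comment> \<open>\<open>n\<close> is the minimum of \<open>N\<close> and \<open>D\<close>,
      which treats finite and infinite depth alike.\<close>
    obtain n where n: "enat n \<le> D" "\<And>t. t < N \<Longrightarrow> (enat t < D \<longleftrightarrow> t < n)" "n \<le> N"
    proof (cases "enat N \<le> D")
      case True
      have "enat t < D" if "t < N" for t using that True by (meson enat_ord_simps(2) order_less_le_trans)
      then show ?thesis using that[of N] True by auto
    next
      case False
      then obtain m where "D = enat m" "m < N" by (cases D) auto
      then show ?thesis using that[of m] by auto
    qed
    have "(\<Sum>t<N. if enat t < D then ennreal (gap st (pref b t)) else 0)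
      = (\<Sum>t<N. if t < n then ennreal (gap st (pref b t)) else 0)"
      using n(2) by (intro sum.cong) auto
    also have "\<dots> = (\<Sum>t<n. ennreal (gap st (pref b t)))"
      using n(3) by (simp add: sum.If_cases) (intro sum.cong, auto)
    also have "\<dots> = ennreal (\<Sum>t<n. gap st (pref b t))" by (intro sum_ennreal) (auto simp: gap0)
    also have "\<dots> \<le> ennreal B" using part[OF n(1)] by (rule ennreal_leI)
    finally show "(\<Sum>t<N. if enat t < D then ennreal (gap st (pref b t)) else 0) \<le> ennreal B" .
  qed auto
  then show "(INF b. branch_gain D st b) \<le> ennreal B" by (meson INF_lower2 UNIV_I)
qed

section \<open>Perceptron covers of linear functions\<close>

definition dot :: "nat \<Rightarrow> (nat \<Rightarrow> real) \<Rightarrow> (nat \<Rightarrow> real) \<Rightarrow> real" where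
  "dot d x y = (\<Sum>i<d. x i * y i)"

lemma dot_self_nonneg: "0 \<le> dot d x x"
  by (simp add: dot_def sum_nonneg)

lemma dot_diff_left: "dot d (\<lambda>i. u i - c * x i) y = dot d u y - c * dot d x y"
  by (simp add: dot_def left_diff_distrib sum_subtractf sum_distrib_left mult.assoc)

lemma dot_commute: "dot d x y = dot d y x"
  by (simp add: dot_def mult.commute)

lemma dot_abs_le: 
  assumes "dot d x x \<le> 1" "dot d w w \<le> 1" shows "\<bar>dot d w x\<bar> \<le> 1"
proof -
  have "(dot d w x)\<^sup>2 \<le> dot d w w * dot d x x"
    using Cauchy_Schwarz_ineq_sum[of w x "{..<d}"] by (simp add: dot_def power2_eq_square)
  also have "\<dots> \<le> 1" using mult_mono[OF assms(2) assms(1)] dot_self_nonneg[of d] by simp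
  finally show ?thesis by (simp add: abs_square_le_1)
qed

lemma dot_zero: assumes "dot d x x = 0" shows "dot d w x = 0"
proof -
  have "(dot d w x)\<^sup>2 \<le> dot d w w * dot d x x"
    using Cauchy_Schwarz_ineq_sum[of w x "{..<d}"] by (simp add: dot_def power2_eq_square)
  then show ?thesis using assms by simp
qed

text \<open>\<open>r\<close> is the residual on an example of squared norm \<open>q\<close>, and
  \<open>m\<close> counts repeated updates of size \<open>a\<close>. The first two terms of the
  second conjunct are the change of the squared distance, so each update is charged
  \<open>a\<^sup>2\<close>. The least \<open>m\<close> reaching residual \<open>a\<close> works:
  each update moves the residual by \<open>a * q \<le> a\<close>, hence does not overshoot
  zero.\<close>

lemma perceptron_step_nonneg:
  fixes r q a :: real
  assumes "0 < a" "0 \<le> q" "q \<le> 1" "q = 0 \<Longrightarrow> r = 0" "0 \<le> r"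
  shows "\<exists>m::nat. \<bar>r - a * m * q\<bar> \<le> a \<and> - 2 * a * m * r + a\<^sup>2 * (of_nat m)\<^sup>2 * q + a\<^sup>2 * m \<le> 0"
proof (cases "r \<le> a")
  case True
  then show ?thesis using assms by (intro exI[of _ 0]) auto
next
  case False
  with assms have q: "0 < q" by fastforce
  have "\<exists>m::nat. r - a * m * q \<le> a"
  proof -
    obtain m :: nat where "(r - a) / (a * q) < m" using reals_Archimedean2 by blast
    then have "r - a < m * (a * q)" using q assms(1) by (simp add: pos_divide_less_eq)
    then show ?thesis by (intro exI[of _ m]) (simp add: algebra_simps)
  qed
  then obtain m :: nat where m: "r - a * m * q \<le> a" "\<And>j. j < m \<Longrightarrow> \<not> r - a * j * q \<le> a"
    using exists_least_iff[of "\<lambda>m::nat. r - a * m * q \<le> a"] by blast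
  with False obtain j where j: "m = Suc j" by (cases m) auto
  then have big: "r - a * j * q > a" using m(2)[of j] by simp
  have aq: "a * q \<le> a" using assms by simp
  have lo: "r - a * m * q \<ge> 0" using big aq by (simp add: j algebra_simps)
  \<comment> \<open>Adding \<open>big\<close> and \<open>lo\<close> puts \<open>2 * r\<close> above
    \<open>a + a * j * q + a * m * q\<close>.\<close>
  have "- 2 * r + a * m * q + a \<le> 0"
  proof -
    have "0 \<le> a * q * j" using assms by (intro mult_nonneg_nonneg) auto
    with big lo show ?thesis unfolding j by (simp add: algebra_simps)
  qed
  then have "(a * m) * (- 2 * r + a * m * q + a) \<le> 0"
    using assms(1) by (intro mult_nonneg_nonpos) auto
  then have "- 2 * a * m * r + a\<^sup>2 * (of_nat m)\<^sup>2 * q + a\<^sup>2 * m \<le> 0"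
    by (simp add: power2_eq_square algebra_simps)
  then show ?thesis using lo m(1) by (intro exI[of _ m]) auto
qed

lemma perceptron_step:
  fixes r q a :: real
  assumes "0 < a" "0 \<le> q" "q \<le> 1" "q = 0 \<Longrightarrow> r = 0"
  shows "\<exists>m::int. \<bar>r - a * m * q\<bar> \<le> a \<and> - 2 * a * m * r + a\<^sup>2 * (of_int m)\<^sup>2 * q + a\<^sup>2 * \<bar>m\<bar> \<le> 0"
proof (cases "0 \<le> r")
  case True
  obtain m :: nat where "\<bar>r - a * m * q\<bar> \<le> a" "- 2 * a * m * r + a\<^sup>2 * (of_nat m)\<^sup>2 * q + a\<^sup>2 * m \<le> 0"
    using perceptron_step_nonneg[of a q r] assms True by metis
  then show ?thesis by (intro exI[of _ "int m"]) simp
next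
  case False
  then have "0 \<le> - r" "q = 0 \<Longrightarrow> - r = 0" using assms(4) by auto
  then obtain m :: nat where "\<bar>- r - a * m * q\<bar> \<le> a" "- 2 * a * m * (- r) + a\<^sup>2 * (of_nat m)\<^sup>2 * q + a\<^sup>2 * m \<le> 0"
    using perceptron_step_nonneg[of a q "- r"] assms(1-3) by metis
  then show ?thesis by (intro exI[of _ "- int m"]) (simp add: abs_minus_commute)
qed

text \<open>\<open>p t\<close> is the signed number of perceptron updates made on the example at time \<open>t\<close>.\<close>

definition patterns :: "nat \<Rightarrow> nat \<Rightarrow> (nat \<Rightarrow> int) set" where
  "patterns n N = {p. (\<forall>t\<ge>n. p t = 0) \<and> (\<Sum>t<n. \<bar>p t\<bar>) \<le> int N}"

lemma patterns_0: "patterns n 0 = {\<lambda>_. 0}"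
proof -
  have "p t = 0" if "p \<in> patterns n 0" for p t
  proof (cases "t < n")
    case True
    have "(\<Sum>t<n. \<bar>p t\<bar>) = 0" using that by (intro antisym sum_nonneg) (auto simp: patterns_def)
    then show ?thesis using True by (simp add: sum_nonneg_eq_0_iff)
  qed (use that in \<open>auto simp: patterns_def\<close>)
  then show ?thesis by (auto simp: patterns_def)
qed

text \<open>Undoing one update where \<open>p\<close> is nonzero lowers the total by one; restoring
  it takes a time and a sign, at most \<open>2 * n\<close> choices. Hence the base
  \<open>2 * n + 1\<close> in the count below.\<close>

lemma patterns_Suc:
  "patterns n (Suc N) \<subseteq> (\<lambda>(p, t, s). p(t := p t + s)) ` (patterns n N \<times> {..<n} \<times> {1, -1}) \<union> patterns n N"
proof
  fix p assume p: "p \<in> patterns n (Suc N)"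
  show "p \<in> (\<lambda>(p, t, s). p(t := p t + s)) ` (patterns n N \<times> {..<n} \<times> {1, -1}) \<union> patterns n N"
  proof (cases "p \<in> patterns n N")
    case False
    then have "(\<Sum>t<n. \<bar>p t\<bar>) \<noteq> 0" using p by (auto simp: patterns_def)
    then obtain t where t: "t < n" "p t \<noteq> 0" by (metis abs_zero lessThan_iff sum.neutral)
    define q where "q = p(t := p t - sgn (p t))"
    have "(\<Sum>t<n. \<bar>q t\<bar>) = \<bar>q t\<bar> + (\<Sum>u\<in>{..<n} - {t}. \<bar>q u\<bar>)" using t by (simp add: sum.remove)
    moreover have "(\<Sum>t<n. \<bar>p t\<bar>) = \<bar>p t\<bar> + (\<Sum>u\<in>{..<n} - {t}. \<bar>p u\<bar>)" using t by (simp add: sum.remove)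
    moreover have "(\<Sum>u\<in>{..<n} - {t}. \<bar>q u\<bar>) = (\<Sum>u\<in>{..<n} - {t}. \<bar>p u\<bar>)" by (simp add: q_def)
    moreover have "\<bar>q t\<bar> = \<bar>p t\<bar> - 1" using t by (auto simp: q_def sgn_if)
    ultimately have "q \<in> patterns n N" using p t by (auto simp: patterns_def q_def)
    moreover have "p = (\<lambda>(p, t, s). p(t := p t + s)) (q, t, sgn (p t))" by (auto simp: q_def)
    moreover have "sgn (p t) \<in> {1, -1}" using t by (auto simp: sgn_if)
    ultimately show ?thesis using t by (intro UnI1 image_eqI) auto
  qed auto
qed

lemma patterns_finite_card: "finite (patterns n N) \<and> card (patterns n N) \<le> (2 * n + 1) ^ N"
proof (induction N)
  case 0
  then show ?case by (simp add: patterns_0)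
next
  case (Suc N)
  let ?A = "patterns n N \<times> {..<n} \<times> {1, -1 :: int}"
  let ?f = "\<lambda>(p, t, s). p(t := p t + s)"
  have fin: "finite (?f ` ?A \<union> patterns n N)" using Suc by auto
  have "card (patterns n (Suc N)) \<le> card (?f ` ?A \<union> patterns n N)"
    by (rule card_mono[OF fin patterns_Suc])
  also have "\<dots> \<le> card (?f ` ?A) + card (patterns n N)" by (rule card_Un_le)
  also have "\<dots> \<le> card ?A + card (patterns n N)" using Suc by (intro add_mono card_image_le) auto
  also have "\<dots> = (2 * n + 1) * card (patterns n N)" by (simp add: card_cartesian_product)
  also have "\<dots> \<le> (2 * n + 1) * (2 * n + 1) ^ N" using Suc by (intro mult_left_mono) auto
  finally show ?case using finite_subset[OF patterns_Suc fin] by simp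
qed

text \<open>The weight vectors reachable by an online perceptron that updates only when its error exceeds
  \<open>a\<close>: each update decreases the squared distance to \<open>w\<close> by \<open>a\<^sup>2\<close>, so at most \<open>1 / a\<^sup>2\<close> updates occur.\<close>

lemma perceptron_cover:
  fixes x :: "nat \<Rightarrow> nat \<Rightarrow> real"
  assumes x: "\<And>t. t < n \<Longrightarrow> dot d (x t) (x t) \<le> 1" and w: "dot d w w \<le> 1"
    and a: "0 < a" "1 \<le> a\<^sup>2 * real N"
  shows "\<exists>p\<in>patterns n N. \<forall>t<n. \<bar>dot d w (x t) - a * (\<Sum>\<tau>\<le>t. p \<tau> * dot d (x \<tau>) (x t))\<bar> \<le> a"
proof -
  \<comment> \<open>\<open>u p t\<close> is \<open>w\<close> minus the perceptron's weight vector
    before the updates of time \<open>t\<close>.\<close>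
  define u where "u p t = (\<lambda>i. w i - a * (\<Sum>\<tau><t. of_int (p \<tau>) * x \<tau> i))" for p :: "nat \<Rightarrow> int" and t
  have u_cong: "u p t = u q t" if "\<And>\<tau>. \<tau> < t \<Longrightarrow> p \<tau> = q \<tau>" for p q t
    using that by (auto simp: u_def)
  have u_Suc: "u p (Suc t) = (\<lambda>i. u p t i - (a * of_int (p t)) * x t i)" for p t
    by (auto simp: u_def algebra_simps)
  \<comment> \<open>The middle conjunct is the mistake-bound invariant. Accuracy at \<open>t\<close>
    is measured after the updates of time \<open>t\<close>, hence \<open>Suc t\<close>.\<close>
  have "\<exists>p. (\<forall>t\<ge>m. p t = 0) \<and> dot d (u p m) (u p m) + a\<^sup>2 * (\<Sum>t<m. \<bar>p t\<bar>) \<le> 1 \<and>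
     (\<forall>t<m. \<bar>dot d (u p (Suc t)) (x t)\<bar> \<le> a)" if "m \<le> n" for m
    using that
  proof (induction m)
    case 0
    show ?case by (rule exI[of _ "\<lambda>_. 0"]) (use w in \<open>auto simp: u_def\<close>)
  next
    case (Suc m)
    then obtain p where p: "\<And>t. t\<ge>m \<Longrightarrow> p t = 0" "dot d (u p m) (u p m) + a\<^sup>2 * (\<Sum>t<m. \<bar>p t\<bar>) \<le> 1"
      "\<And>t. t<m \<Longrightarrow> \<bar>dot d (u p (Suc t)) (x t)\<bar> \<le> a" by auto
    define r where "r = dot d (u p m) (x m)"
    define q where "q = dot d (x m) (x m)"
    obtain k :: int where k: "\<bar>r - a * k * q\<bar> \<le> a" "- 2 * a * k * r + a\<^sup>2 * k\<^sup>2 * q + a\<^sup>2 * \<bar>k\<bar> \<le> 0"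
      using perceptron_step[of a q r] a x[of m] Suc.prems dot_zero dot_self_nonneg
      by (auto simp: q_def r_def)
    define p' where "p' = p(m := k)"
    \<comment> \<open>Setting entry \<open>m\<close> leaves the residuals up to \<open>m\<close>
      unchanged, so the accuracy already achieved persists.\<close>
    have low: "u p' t = u p t" if "t \<le> m" for t using that by (intro u_cong) (auto simp: p'_def)
    have uS: "u p' (Suc m) = (\<lambda>i. u p m i - (a * k) * x m i)"
      by (simp only: u_Suc low[OF order_refl]) (simp add: p'_def)
    have "dot d (u p' (Suc m)) (u p' (Suc m)) = dot d (u p m) (u p m) - 2 * a * k * r + a\<^sup>2 * k\<^sup>2 * q"
    proof -
      have "dot d (u p' (Suc m)) y = dot d (u p m) y - a * k * dot d (x m) y" for y
        unfolding uS by (rule dot_diff_left)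
      note this[of "u p' (Suc m)"] this[of "u p m"] this[of "x m"]
      then show ?thesis
        unfolding r_def q_def dot_commute[of d "u p m" "u p' (Suc m)"] dot_commute[of d "x m" "u p' (Suc m)"]
          dot_commute[of d "x m" "u p m"]
        by (simp add: power2_eq_square algebra_simps)
    qed
    moreover have "(\<Sum>t<Suc m. \<bar>p' t\<bar>) = (\<Sum>t<m. \<bar>p t\<bar>) + \<bar>k\<bar>" by (simp add: p'_def)
    ultimately have "dot d (u p' (Suc m)) (u p' (Suc m)) + a\<^sup>2 * (\<Sum>t<Suc m. \<bar>p' t\<bar>) \<le> 1"
      using p(2) k(2) by (simp add: algebra_simps del: sum.lessThan_Suc)
    moreover have "\<bar>dot d (u p' (Suc m)) (x m)\<bar> \<le> a"
      unfolding uS dot_diff_left using k(1) by (simp add: r_def q_def)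
    moreover have "\<bar>dot d (u p' (Suc t)) (x t)\<bar> \<le> a" if "t < m" for t
      using low[of "Suc t"] p(3)[of t] that by simp
    moreover have "p' t = 0" if "t \<ge> Suc m" for t using p(1) that by (simp add: p'_def)
    ultimately show ?case by (intro exI[of _ p']) (auto simp: less_Suc_eq simp del: sum.lessThan_Suc)
  qed
  from this[of n] obtain p where p: "\<And>t. t\<ge>n \<Longrightarrow> p t = 0" "dot d (u p n) (u p n) + a\<^sup>2 * (\<Sum>t<n. \<bar>p t\<bar>) \<le> 1"
      "\<And>t. t<n \<Longrightarrow> \<bar>dot d (u p (Suc t)) (x t)\<bar> \<le> a" by auto
  have "a\<^sup>2 * real_of_int (\<Sum>t<n. \<bar>p t\<bar>) \<le> a\<^sup>2 * real N"
    using p(2) dot_self_nonneg[of d "u p n"] a(2) by linarith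
  then have "real_of_int (\<Sum>t<n. \<bar>p t\<bar>) \<le> real_of_int (int N)"
    using a(1) by (simp only: mult_le_cancel_left_pos zero_less_power of_int_of_nat_eq)
  then have "(\<Sum>t<n. \<bar>p t\<bar>) \<le> int N" by (simp only: of_int_le_iff)
  then have "p \<in> patterns n N" using p(1) by (simp add: patterns_def)
  moreover have "dot d (u p (Suc t)) (x t) = dot d w (x t) - a * (\<Sum>\<tau>\<le>t. p \<tau> * dot d (x \<tau>) (x t))" for t
  proof -
    have "dot d (\<lambda>i. \<Sum>\<tau><Suc t. of_int (p \<tau>) * x \<tau> i) (x t) = (\<Sum>\<tau><Suc t. p \<tau> * dot d (x \<tau>) (x t))"
      unfolding dot_def sum_distrib_right sum_distrib_left by (subst sum.swap) (simp add: mult.assoc)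
    then show ?thesis unfolding u_def dot_diff_left by (simp add: lessThan_Suc_atMost)
  qed
  ultimately show ?thesis using p(3) by (intro bexI[of _ p]) auto
qed

section \<open>Sub-Gaussian growth of soft maxima\<close>

text \<open>The difference \<open>x\<^sup>2 / 2 - ln (cosh x)\<close> has derivative
  \<open>x - tanh x\<close>, nonnegative for \<open>x \<ge> 0\<close>; evenness does the
  rest.\<close>

lemma cosh_le_exp_half_square: "cosh x \<le> exp (x\<^sup>2 / 2)" for x :: real
proof -
  have sinh: "sinh y \<le> y * cosh y" if "0 \<le> y" for y :: real
  proof -
    have "0 * cosh 0 - sinh 0 \<le> y * cosh y - sinh y"
      by (rule DERIV_nonneg_imp_nondecreasing[OF that])
        (auto intro!: exI derivative_eq_intros simp: algebra_simps)
    then show ?thesis by simp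
  qed
  have pos: "cosh y \<le> exp (y\<^sup>2 / 2)" if "0 \<le> y" for y :: real
  proof -
    have "0\<^sup>2 / 2 - ln (cosh 0) \<le> y\<^sup>2 / 2 - ln (cosh y)"
    proof (rule DERIV_nonneg_imp_nondecreasing[OF that])
      fix z :: real assume z: "0 \<le> z" "z \<le> y"
      have "((\<lambda>y. y\<^sup>2 / 2 - ln (cosh y)) has_real_derivative z - sinh z / cosh z) (at z)"
        by (auto intro!: derivative_eq_intros simp: field_simps)
      moreover have "sinh z / cosh z \<le> z" using sinh[OF z(1)] by (simp add: field_simps)
      ultimately show "\<exists>D. ((\<lambda>y. y\<^sup>2 / 2 - ln (cosh y)) has_real_derivative D) (at z) \<and> 0 \<le> D" by auto
    qed
    then have "ln (cosh y) \<le> y\<^sup>2 / 2" by simp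
    then have "exp (ln (cosh y)) \<le> exp (y\<^sup>2 / 2)" by (simp only: exp_le_cancel_iff)
    then show ?thesis by (simp only: exp_ln cosh_real_pos)
  qed
  from pos[of x] pos[of "- x"] show ?thesis by (cases "0 \<le> x") simp_all
qed

text \<open>Averaging over the two signs yields \<open>cosh (l * S a) * cosh (l * g a)\<close>, and
  AM-GM passes from the average of logarithms to the logarithm of the average. With
  \<open>cosh\<close> in place of \<open>exp\<close> both signs of \<open>S\<close> are controlled
  at once.\<close>

lemma soft_max_step:
  fixes S g :: "'b \<Rightarrow> real"
  assumes fin: "finite A" "A \<noteq> {}" and l: "0 < l" and g: "\<And>a. a \<in> A \<Longrightarrow> \<bar>g a\<bar> \<le> c"
  shows "(ln (\<Sum>a\<in>A. cosh (l * (S a + g a))) + ln (\<Sum>a\<in>A. cosh (l * (S a - g a)))) / 2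
     \<le> ln (\<Sum>a\<in>A. cosh (l * S a)) + l\<^sup>2 * c\<^sup>2 / 2"
proof -
  define P where "P = (\<Sum>a\<in>A. cosh (l * (S a + g a)))"
  define Q where "Q = (\<Sum>a\<in>A. cosh (l * (S a - g a)))"
  define Z where "Z = (\<Sum>a\<in>A. cosh (l * S a))"
  have pos: "0 < P" "0 < Q" "0 < Z" unfolding P_def Q_def Z_def using fin by (auto intro!: sum_pos)
  have "(P + Q) / 2 = (\<Sum>a\<in>A. cosh (l * S a) * cosh (l * g a))"
    unfolding P_def Q_def sum.distrib[symmetric] sum_divide_distrib
    by (intro sum.cong) (auto simp: distrib_left right_diff_distrib cosh_add cosh_diff)
  also have "\<dots> \<le> (\<Sum>a\<in>A. cosh (l * S a) * exp (l\<^sup>2 * c\<^sup>2 / 2))"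
  proof (intro sum_mono mult_left_mono)
    fix a assume a: "a \<in> A"
    have "(g a)\<^sup>2 \<le> c\<^sup>2" using g[OF a] by (metis abs_ge_zero power2_abs power_mono)
    then have "(l * g a)\<^sup>2 / 2 \<le> l\<^sup>2 * c\<^sup>2 / 2" by (simp add: power_mult_distrib mult_left_mono)
    then show "cosh (l * g a) \<le> exp (l\<^sup>2 * c\<^sup>2 / 2)"
      using cosh_le_exp_half_square[of "l * g a"] by (meson exp_le_cancel_iff order_trans)
  qed auto
  also have "\<dots> = Z * exp (l\<^sup>2 * c\<^sup>2 / 2)" by (simp add: Z_def sum_distrib_right)
  finally have *: "(P + Q) / 2 \<le> Z * exp (l\<^sup>2 * c\<^sup>2 / 2)" .
  have "P * Q \<le> ((P + Q) / 2)\<^sup>2" using sum_squares_bound[of P Q] by (simp add: power2_eq_square field_simps)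
  then have "ln (P * Q) \<le> ln (((P + Q) / 2)\<^sup>2)" using pos by simp
  then have "(ln P + ln Q) / 2 \<le> ln ((P + Q) / 2)" using pos by (simp add: ln_mult ln_realpow)
  also have "\<dots> \<le> ln (Z * exp (l\<^sup>2 * c\<^sup>2 / 2))" using * pos by simp
  also have "\<dots> = ln Z + l\<^sup>2 * c\<^sup>2 / 2" using pos by (simp add: ln_mult)
  finally show ?thesis by (simp add: P_def Q_def Z_def)
qed

section \<open>Sequential chaining\<close>

text \<open>Among the two children of a node there is one along which the potential grows by at most its
  average growth.\<close>

lemma adversarial_path:
  fixes \<Phi> :: "('a \<times> real \<times> real) list \<Rightarrow> real"
  assumes step: "\<And>zs x s. (\<Phi> (zs @ [(x, s, 1)]) + \<Phi> (zs @ [(x, s, -1)])) / 2 \<le> \<Phi> zs + c"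
    and bnd: "\<forall>h\<in>V. \<forall>x\<in>X. \<bar>h x\<bar> \<le> 1"
    and sh: "shatters X e n V"
  shows "\<exists>h\<in>V. \<exists>ys. length ys = n \<and>
    (\<forall>(x, s, \<sigma>)\<in>set ys. x \<in> X \<and> \<bar>s\<bar> \<le> 1 \<and> (\<sigma> = 1 \<or> \<sigma> = -1) \<and> e / 2 \<le> \<sigma> * (h x - s)) \<and>
    \<Phi> (zs @ ys) \<le> \<Phi> zs + n * c"
  using bnd sh
proof (induction n arbitrary: V zs)
  case 0
  then show ?case by auto
next
  case (Suc n)
  then obtain x s0 s1 where x: "x \<in> X" "s0 + e \<le> s1"
    "shatters X e n {h\<in>V. h x = s0}" "shatters X e n {h\<in>V. h x = s1}" by auto
  define s where "s = (s0 + s1) / 2"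
  have "\<bar>s0\<bar> \<le> 1" "\<bar>s1\<bar> \<le> 1"
    using shatters_nonempty[OF x(3)] shatters_nonempty[OF x(4)] Suc.prems(1) x(1) by auto
  then have s: "\<bar>s\<bar> \<le> 1" by (auto simp: s_def abs_le_iff)
  have sub: "\<forall>h\<in>{h\<in>V. h x = v}. \<forall>x\<in>X. \<bar>h x\<bar> \<le> 1" for v
    using Suc.prems(1) by auto
  obtain \<sigma> v where \<sigma>: "\<sigma> = 1 \<and> v = s1 \<or> \<sigma> = -1 \<and> v = s0"
    and le: "\<Phi> (zs @ [(x, s, \<sigma>)]) \<le> \<Phi> zs + c"
  proof (cases "\<Phi> (zs @ [(x, s, 1)]) \<le> \<Phi> zs + c")
    case True
    then show ?thesis by (intro that[of 1 s1]) auto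
  next
    case False
    moreover have "\<Phi> (zs @ [(x, s, 1)]) + \<Phi> (zs @ [(x, s, -1)]) \<le> 2 * (\<Phi> zs + c)"
      using step[of zs x s] by (simp add: field_simps)
    ultimately show ?thesis by (intro that[of "-1" s0]) auto
  qed
  have "shatters X e n {h\<in>V. h x = v}" using \<sigma> x by auto
  from Suc.IH[OF sub this, of "zs @ [(x, s, \<sigma>)]"]
  obtain h ys where h: "h \<in> V" "h x = v" and ys: "length ys = n"
    "\<forall>(x, s, \<sigma>)\<in>set ys. x \<in> X \<and> \<bar>s\<bar> \<le> 1 \<and> (\<sigma> = 1 \<or> \<sigma> = -1) \<and> e / 2 \<le> \<sigma> * (h x - s)"
    "\<Phi> ((zs @ [(x, s, \<sigma>)]) @ ys) \<le> \<Phi> (zs @ [(x, s, \<sigma>)]) + n * c" by auto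
  have "e / 2 \<le> \<sigma> * (h x - s)" using \<sigma> h(2) x(2) by (auto simp: s_def field_simps)
  moreover have "\<Phi> (zs @ (x, s, \<sigma>) # ys) \<le> \<Phi> zs + Suc n * c"
    using ys(3) le by (simp add: algebra_simps)
  ultimately show ?case using h(1) ys(1,2) \<sigma> x(1) s
    by (intro bexI[OF _ h(1)] exI[of _ "(x, s, \<sigma>) # ys"]) auto
qed

text \<open>The lists \<open>zs\<close> record a path: node, midpoint of its two labels, and the sign telling which label
  was taken.\<close>

definition corr :: "('a list \<Rightarrow> real) \<Rightarrow> ('a \<times> real \<times> real) list \<Rightarrow> real" where
  "corr g zs = (\<Sum>t<length zs. snd (snd (zs ! t)) * g (take (Suc t) (map fst zs)))"

lemma corr_Nil [simp]: "corr g [] = 0"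
  by (simp add: corr_def)

lemma corr_snoc: "corr g (zs @ [(x, s, \<sigma>)]) = corr g zs + \<sigma> * g (map fst zs @ [x])"
  by (simp add: corr_def nth_append)

text \<open>The soft maximum dominates every absolute value up to \<open>ln 2 / l\<close>, because
  \<open>exp \<bar>y\<bar> \<le> 2 * cosh y\<close>.\<close>

lemma abs_le_ln_cosh_sum:
  assumes "finite A" "a \<in> A" "0 < l"
  shows "\<bar>S a\<bar> \<le> (ln 2 + ln (\<Sum>a\<in>A. cosh (l * S a))) / (l :: real)"
proof -
  have "exp (l * \<bar>S a\<bar>) \<le> 2 * cosh (l * S a)"
    by (cases "0 \<le> S a") (simp_all add: cosh_field_def)
  also have "cosh (l * S a) \<le> (\<Sum>a\<in>A. cosh (l * S a))"
    using assms by (intro member_le_sum) auto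
  finally have le: "exp (l * \<bar>S a\<bar>) \<le> 2 * (\<Sum>a\<in>A. cosh (l * S a))" by simp
  have pos: "0 < (\<Sum>a\<in>A. cosh (l * S a))" using assms by (intro sum_pos) auto
  have "l * \<bar>S a\<bar> \<le> ln (2 * (\<Sum>a\<in>A. cosh (l * S a)))"
    using le pos by (simp add: ln_ge_iff)
  also have "\<dots> = ln 2 + ln (\<Sum>a\<in>A. cosh (l * S a))" using pos by (simp add: ln_mult)
  finally show ?thesis using assms(3) by (simp add: field_simps)
qed

text \<open>As \<open>s\<close> lies in [-1,1], a positive margin means that clipping can only have
  pulled \<open>z\<close> towards \<open>s\<close>. Removing the clip makes the margin linear in the
  units.\<close>

lemma clip_margin:
  assumes "\<sigma> = 1 \<or> \<sigma> = -1" "\<bar>s\<bar> \<le> 1" "0 < e" "e \<le> \<sigma> * (clip z - s)"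
  shows "e \<le> \<sigma> * (z - s)"
  using assms by (auto simp: clip_def max_def min_def split: if_splits)

lemma abs_clip_le: "\<bar>clip z\<bar> \<le> 1"
  by (auto simp: clip_def)

text \<open>Derandomised sequential chaining: the potential is a sum over the dyadic scales of the soft maxima
  of the martingales formed by the links of the chain.\<close>

lemma shatters_chaining_bound:
  fixes E :: "nat \<Rightarrow> ('a list \<Rightarrow> real) set" and \<mu> L e :: real and k :: nat
  assumes E: "\<And>i. i \<le> M \<Longrightarrow> finite (E i)" "\<And>i. i \<le> M \<Longrightarrow> E i \<noteq> {}" "E 0 = {\<lambda>_. 0}"
    and card: "\<And>i. i \<le> M \<Longrightarrow> ln (card (E i)) \<le> 4 ^ i * L"
    and cover: "\<And>i f xs. i \<le> M \<Longrightarrow> f \<in> F \<Longrightarrow> length xs = n \<Longrightarrow> set xs \<subseteq> X \<Longrightarrow>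
        \<exists>g\<in>E i. \<forall>t<n. \<bar>g (take (Suc t) xs) - f (xs ! t)\<bar> \<le> 1 / 2 ^ i"
    and rep: "\<And>h. h \<in> V \<Longrightarrow> \<exists>a f. (\<forall>j<k. \<bar>a j\<bar> \<le> 1 \<and> f j \<in> F) \<and>
        (\<forall>x\<in>X. h x = clip (\<Sum>j<k. a j * f j x))"
    and sh: "shatters X e n V" and e: "0 < e" and \<mu>: "0 < \<mu>" and L: "ln 2 \<le> L"
  shows "n * e / 2 \<le> k * (n / 2 ^ M + M * (6 * L / \<mu> + 2 * real n * \<mu>))"
proof -
  \<comment> \<open>Entropy grows like \<open>4 ^ i\<close> and squared links shrink like
    \<open>1 / 4 ^ i\<close>; this choice makes both costs, \<open>6 * L / \<mu>\<close> in total
    and \<open>2 * \<mu>\<close> per round, independent of the scale.\<close>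
  define l where "l i = \<mu> * 4 ^ i" for i :: nat
  have l: "0 < l i" for i using \<mu> by (simp add: l_def)
  \<comment> \<open>Truncation bounds the links of all pairs of experts, as
    \<open>soft_max_step\<close> requires; it is inactive on pairs approximating the same
    function.\<close>
  define link where "link i a us = max (- (2 / 2 ^ i)) (min (2 / 2 ^ i) (snd a us - fst a us))"
    for i :: nat and a :: "('a list \<Rightarrow> real) \<times> ('a list \<Rightarrow> real)" and us
  have link: "\<bar>link i a us\<bar> \<le> 2 / 2 ^ i" for i a us
    by (auto simp: link_def abs_le_iff max_def min_def)
  define A where "A i = E i \<times> E (Suc i)" for i
  have A: "finite (A i)" "A i \<noteq> {}" if "i < M" for i using E that by (auto simp: A_def)
  define Z where "Z i zs = (\<Sum>a\<in>A i. cosh (l i * corr (link i a) zs))" for i zs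
  define sc where "sc zs = (\<Sum>t<length zs. snd (snd (zs ! t)) * fst (snd (zs ! t)))" for zs :: "('a \<times> real \<times> real) list"
  \<comment> \<open>The factor \<open>k\<close> provides the soft maxima once per unit. The midpoint
    term \<open>sc\<close> changes by \<open>s\<close> or \<open>-s\<close>, so it averages out over
    the two children.\<close>
  define \<Phi> where "\<Phi> zs = k * (\<Sum>i<M. ln (Z i zs) / l i) - sc zs" for zs
  have sc_snoc: "sc (zs @ [(x, s, \<sigma>)]) = sc zs + \<sigma> * s" for zs x s \<sigma>
    by (simp add: sc_def nth_append)
  have step: "(\<Phi> (zs @ [(x, s, 1)]) + \<Phi> (zs @ [(x, s, -1)])) / 2 \<le> \<Phi> zs + k * (M * (2 * \<mu>))" for zs x s
  proof -
    have "(ln (Z i (zs @ [(x, s, 1)])) / l i + ln (Z i (zs @ [(x, s, -1)])) / l i) / 2 \<le> ln (Z i zs) / l i + 2 * \<mu>"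
      if "i < M" for i
    proof -
      have "(ln (Z i (zs @ [(x, s, 1)])) + ln (Z i (zs @ [(x, s, -1)]))) / 2
          \<le> ln (Z i zs) + (l i)\<^sup>2 * (2 / 2 ^ i)\<^sup>2 / 2"
        using soft_max_step[where A = "A i" and l = "l i" and c = "2 / 2 ^ i" and S = "\<lambda>a. corr (link i a) zs"
          and g = "\<lambda>a. link i a (map fst zs @ [x])"] link A[OF that] l[of i]
        by (simp add: Z_def corr_snoc)
      also have "(l i)\<^sup>2 * (2 / 2 ^ i)\<^sup>2 / 2 = l i * (2 * \<mu>)"
        by (simp add: l_def power_divide square_two_power) (simp add: power2_eq_square)
      finally have "(ln (Z i (zs @ [(x, s, 1)])) + ln (Z i (zs @ [(x, s, -1)]))) / 2 / l i
          \<le> (ln (Z i zs) + l i * (2 * \<mu>)) / l i"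
        using l[of i] by (intro divide_right_mono) auto
      then show ?thesis using l[of i] by (simp add: add_divide_distrib)
    qed
    then have "(\<Sum>i<M. (ln (Z i (zs @ [(x, s, 1)])) / l i + ln (Z i (zs @ [(x, s, -1)])) / l i) / 2)
        \<le> (\<Sum>i<M. ln (Z i zs) / l i + 2 * \<mu>)" by (intro sum_mono) auto
    from mult_left_mono[OF this, of "real k"]
    have "real k * (\<Sum>i<M. (ln (Z i (zs @ [(x, s, 1)])) / l i + ln (Z i (zs @ [(x, s, -1)])) / l i) / 2)
        \<le> k * (\<Sum>i<M. ln (Z i zs) / l i + 2 * \<mu>)" by simp
    also have "(\<Sum>i<M. (ln (Z i (zs @ [(x, s, 1)])) / l i + ln (Z i (zs @ [(x, s, -1)])) / l i) / 2)
        = ((\<Sum>i<M. ln (Z i (zs @ [(x, s, 1)])) / l i) + (\<Sum>i<M. ln (Z i (zs @ [(x, s, -1)])) / l i)) / 2"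
      by (simp only: sum_divide_distrib[symmetric] sum.distrib)
    also have "(\<Sum>i<M. ln (Z i zs) / l i + 2 * \<mu>) = (\<Sum>i<M. ln (Z i zs) / l i) + M * (2 * \<mu>)"
      by (simp add: sum.distrib)
    finally show ?thesis by (simp add: \<Phi>_def sc_snoc field_simps)
  qed
  have bnd: "\<forall>h\<in>V. \<forall>x\<in>X. \<bar>h x\<bar> \<le> 1" using rep abs_clip_le by metis
  obtain h ys where h: "h \<in> V" and ys: "length ys = n"
    "\<forall>(x, s, \<sigma>)\<in>set ys. x \<in> X \<and> \<bar>s\<bar> \<le> 1 \<and> (\<sigma> = 1 \<or> \<sigma> = -1) \<and> e / 2 \<le> \<sigma> * (h x - s)"
    "\<Phi> ys \<le> \<Phi> [] + n * (k * (M * (2 * \<mu>)))"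
    using adversarial_path[where zs = "[]" and \<Phi> = \<Phi>, OF step bnd sh] by auto
  define xs where "xs = map fst ys"
  define \<sigma> where "\<sigma> t = snd (snd (ys ! t))" for t
  define s where "s t = fst (snd (ys ! t))" for t
  have xs: "length xs = n" "set xs \<subseteq> X" using ys by (auto simp: xs_def)
  have node: "xs ! t \<in> X" "\<bar>s t\<bar> \<le> 1" "\<sigma> t = 1 \<or> \<sigma> t = -1" "e / 2 \<le> \<sigma> t * (h (xs ! t) - s t)" if "t < n" for t
    using bspec[OF ys(2), of "ys ! t"] that ys(1) by (auto simp: xs_def \<sigma>_def s_def split_beta)
  have corr_ys: "corr g ys = (\<Sum>t<n. \<sigma> t * g (take (Suc t) xs))" for g
    by (simp add: corr_def ys(1) xs_def \<sigma>_def)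
  have sc_ys: "sc ys = (\<Sum>t<n. \<sigma> t * s t)" by (simp add: sc_def ys(1) \<sigma>_def s_def)
  define W where "W = n / 2 ^ M + (\<Sum>i<M. (ln 2 + ln (Z i ys)) / l i)"
  have single: "\<bar>\<Sum>t<n. \<sigma> t * f (xs ! t)\<bar> \<le> W" if f: "f \<in> F" for f
  proof -
    have "\<forall>i\<in>{..M}. \<exists>g. g \<in> E i \<and> (\<forall>t<n. \<bar>g (take (Suc t) xs) - f (xs ! t)\<bar> \<le> 1 / 2 ^ i)"
      using cover[OF _ f xs] by blast
    then obtain g where g: "\<And>i. i \<le> M \<Longrightarrow> g i \<in> E i"
      "\<And>i t. i \<le> M \<Longrightarrow> t < n \<Longrightarrow> \<bar>g i (take (Suc t) xs) - f (xs ! t)\<bar> \<le> 1 / 2 ^ i"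
      unfolding bchoice_iff by auto
    have g0: "g 0 us = 0" for us using g(1)[of 0] E(3) by simp
    have tele: "(\<Sum>t<n. \<sigma> t * f (xs ! t)) =
      (\<Sum>t<n. \<sigma> t * (f (xs ! t) - g M (take (Suc t) xs))) + (\<Sum>i<M. corr (link i (g i, g (Suc i))) ys)"
    proof -
      have lk: "link i (g i, g (Suc i)) (take (Suc t) xs) = g (Suc i) (take (Suc t) xs) - g i (take (Suc t) xs)"
        if "i < M" "t < n" for i t
      proof -
        have "\<bar>g (Suc i) (take (Suc t) xs) - g i (take (Suc t) xs)\<bar> \<le> 1 / 2 ^ Suc i + 1 / 2 ^ i"
          using g(2)[of "Suc i" t] g(2)[of i t] that by linarith
        also have "\<dots> \<le> 2 / 2 ^ i" by (simp add: field_simps)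
        finally show ?thesis by (auto simp: link_def max_def min_def abs_le_iff)
      qed
      have "(\<Sum>i<M. corr (link i (g i, g (Suc i))) ys)
        = (\<Sum>i<M. \<Sum>t<n. \<sigma> t * (g (Suc i) (take (Suc t) xs) - g i (take (Suc t) xs)))"
        unfolding corr_ys by (intro sum.cong) (auto simp: lk)
      also have "\<dots> = (\<Sum>t<n. \<sigma> t * (\<Sum>i<M. g (Suc i) (take (Suc t) xs) - g i (take (Suc t) xs)))"
        by (subst sum.swap) (simp add: sum_distrib_left)
      also have "\<dots> = (\<Sum>t<n. \<sigma> t * g M (take (Suc t) xs))"
        using sum_lessThan_telescope[of "\<lambda>i. g i us" M for us] by (simp add: g0)
      finally show ?thesis by (simp add: right_diff_distrib sum_subtractf)
    qed
    have "\<bar>\<Sum>t<n. \<sigma> t * (f (xs ! t) - g M (take (Suc t) xs))\<bar> \<le> (\<Sum>t<n. 1 / 2 ^ M)"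
    proof (rule order_trans[OF sum_abs sum_mono])
      fix t assume "t \<in> {..<n}"
      then show "\<bar>\<sigma> t * (f (xs ! t) - g M (take (Suc t) xs))\<bar> \<le> 1 / 2 ^ M"
        using node(3)[of t] g(2)[of M t] by (auto simp: abs_mult abs_minus_commute)
    qed
    moreover have "\<bar>\<Sum>i<M. corr (link i (g i, g (Suc i))) ys\<bar> \<le> (\<Sum>i<M. (ln 2 + ln (Z i ys)) / l i)"
    proof (rule order_trans[OF sum_abs sum_mono])
      fix i assume "i \<in> {..<M}"
      then have "(g i, g (Suc i)) \<in> A i" "finite (A i)" using g(1) A by (auto simp: A_def)
      then show "\<bar>corr (link i (g i, g (Suc i))) ys\<bar> \<le> (ln 2 + ln (Z i ys)) / l i"
        unfolding Z_def using abs_le_ln_cosh_sum[OF _ _ l, of "A i" _ "\<lambda>a. corr (link i a) ys"] by auto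
    qed
    ultimately show ?thesis unfolding tele W_def by simp
  qed
  obtain a f where af: "\<forall>j<k. \<bar>a j\<bar> \<le> 1 \<and> f j \<in> F" "\<forall>x\<in>X. h x = clip (\<Sum>j<k. a j * f j x)"
    using rep[OF h] by (elim exE conjE)
  have "n * e / 2 = (\<Sum>t<n. e / 2)" by (simp only: sum_constant card_lessThan times_divide_eq_right)
  also have "\<dots> \<le> (\<Sum>t<n. \<sigma> t * ((\<Sum>j<k. a j * f j (xs ! t)) - s t))"
  proof (rule sum_mono)
    fix t assume "t \<in> {..<n}"
    then show "e / 2 \<le> \<sigma> t * ((\<Sum>j<k. a j * f j (xs ! t)) - s t)"
      using node[of t] af(2) e by - (rule clip_margin, auto)
  qed
  also have "\<dots> = (\<Sum>j<k. a j * (\<Sum>t<n. \<sigma> t * f j (xs ! t))) - sc ys"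
    unfolding sc_ys right_diff_distrib sum_subtractf sum_distrib_left
    by (subst sum.swap) (simp add: mult.left_commute)
  also have "(\<Sum>j<k. a j * (\<Sum>t<n. \<sigma> t * f j (xs ! t))) \<le> (\<Sum>j<k. W)"
  proof (rule sum_mono)
    fix j assume j: "j \<in> {..<k}"
    have "a j * (\<Sum>t<n. \<sigma> t * f j (xs ! t)) \<le> \<bar>a j\<bar> * \<bar>\<Sum>t<n. \<sigma> t * f j (xs ! t)\<bar>"
      by (metis abs_ge_self abs_mult)
    also have "\<dots> \<le> 1 * W" using j af(1) single[of "f j"] by (intro mult_mono) auto
    finally show "a j * (\<Sum>t<n. \<sigma> t * f j (xs ! t)) \<le> W" by simp
  qed
  \<comment> \<open>The soft maxima and \<open>sc\<close> recombine into the potential of the path,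
    which the adversary kept small.\<close>
  also have "(\<Sum>j<k. W) - sc ys = k * (n / 2 ^ M + (\<Sum>i<M. ln 2 / l i)) + \<Phi> ys"
    by (simp add: W_def \<Phi>_def add_divide_distrib sum.distrib algebra_simps)
  also have "\<Phi> ys \<le> \<Phi> [] + n * (k * (M * (2 * \<mu>)))" by (rule ys(3))
  also have "\<Phi> [] = k * (\<Sum>i<M. ln (card (A i)) / l i)" by (simp add: \<Phi>_def Z_def sc_def)
  finally have main: "n * e / 2 \<le> k * (n / 2 ^ M + (\<Sum>i<M. (ln 2 + ln (card (A i))) / l i) + n * (M * (2 * \<mu>)))"
    by (simp add: algebra_simps add_divide_distrib sum.distrib)
  have "(\<Sum>i<M. (ln 2 + ln (card (A i))) / l i) \<le> (\<Sum>i<M. 6 * L / \<mu>)"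
  proof (rule sum_mono)
    fix i assume i: "i \<in> {..<M}"
    have c: "0 < card (E i)" "0 < card (E (Suc i))" using i E by (auto simp: card_gt_0_iff)
    have "ln (card (A i)) = ln (card (E i)) + ln (card (E (Suc i)))"
      using c by (simp add: A_def card_cartesian_product ln_mult)
    moreover have "ln 2 \<le> 4 ^ i * L"
    proof -
      have "0 \<le> L" using L ln_gt_zero[of "2::real"] by linarith
      then have "1 * L \<le> 4 ^ i * L" by (intro mult_right_mono) auto
      then show ?thesis using L by simp
    qed
    \<comment> \<open>In units of \<open>4 ^ i * L\<close> the constant is 1 + 1 + 4:
      \<open>ln 2\<close> and the covers at scales \<open>i\<close> and
      \<open>Suc i\<close>.\<close>
    ultimately have "ln 2 + ln (card (A i)) \<le> 6 * (4 ^ i * L)"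
      using card[of i] card[of "Suc i"] i by simp
    then have "(ln 2 + ln (card (A i))) / l i \<le> 6 * (4 ^ i * L) / l i"
      using l[of i] by (simp add: divide_right_mono)
    then show "(ln 2 + ln (card (A i))) / l i \<le> 6 * L / \<mu>" by (simp add: l_def)
  qed
  then have "k * (n / 2 ^ M + (\<Sum>i<M. (ln 2 + ln (card (A i))) / l i) + n * (M * (2 * \<mu>)))
      \<le> k * (n / 2 ^ M + M * (6 * L / \<mu>) + n * (M * (2 * \<mu>)))"
    by (intro mult_left_mono add_mono) auto
  also have "\<dots> = k * (n / 2 ^ M + M * (6 * L / \<mu> + 2 * real n * \<mu>))" by (simp add: algebra_simps)
  finally have "k * (n / 2 ^ M + (\<Sum>i<M. (ln 2 + ln (card (A i))) / l i) + n * (M * (2 * \<mu>)))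
      \<le> k * (n / 2 ^ M + M * (6 * L / \<mu> + 2 * real n * \<mu>))" .
  from order_trans[OF main this] show ?thesis by simp
qed

section \<open>Chaining bound for the network class\<close>

lemma relu_lipschitz: "\<bar>relu u - relu v\<bar> \<le> \<bar>u - v\<bar>"
  by (auto simp: relu_def)

lemma domX_dot: "x \<in> domX d \<Longrightarrow> dot d x x \<le> 1"
  by (simp add: domX_def dot_def power2_eq_square)

lemma Hkd_cases:
  assumes "h \<in> Hkd k d"
  obtains a w where "\<And>j. j < k \<Longrightarrow> \<bar>a j\<bar> \<le> 1" "\<And>j. j < k \<Longrightarrow> dot d (w j) (w j) \<le> 1"
    "\<And>x. h x = clip (\<Sum>j<k. a j * relu (dot d (w j) x))"
  using assms unfolding Hkd_def dot_def power2_eq_square by blast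

text \<open>The condition on \<open>M\<close> limits the error of the finest cover to half of the
  total margin. The \<open>n\<close> left inside the logarithm is eliminated later by the grid
  bound.\<close>

lemma Hkd_shatters_chaining:
  assumes sh: "shatters (domX d) e n (Hkd k d)" and e: "0 < e" and k: "1 \<le> k" and M: "1 \<le> M" "4 * real k \<le> e * 2 ^ M"
  shows "n * e\<^sup>2 \<le> 768 * (real k)\<^sup>2 * (real M)\<^sup>2 * ln (2 * real n + 1)"
proof (cases "n = 0")
  case False
  define F where "F = {\<lambda>x. relu (dot d w x) | w. dot d w w \<le> 1}"
  \<comment> \<open>An expert sees the nodes up to the current one, \<open>last us\<close>, and
    replays a perceptron of step \<open>1 / 2 ^ i\<close> with update counts prescribed by
    \<open>p\<close>.\<close>
  define expert where "expert i p us = relu (1 / 2 ^ i * (\<Sum>\<tau><length us. real_of_int (p \<tau>) * dot d (us ! \<tau>) (last us)))"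
    for i :: nat and p us
  \<comment> \<open>The units take values in [0,1], so the zero function covers them at scale 1 and
    starts the chain. At step \<open>1 / 2 ^ i\<close> the mistake bound is
    \<open>4 ^ i\<close>.\<close>
  define E where "E i = (if i = 0 then {\<lambda>_. 0} else expert i ` patterns n (4 ^ i))" for i
  define L where "L = ln (2 * real n + 1)"
  have L: "ln 2 \<le> L" using False by (simp add: L_def)
  have L0: "0 \<le> L" by (simp add: L_def)
  have ne: "patterns n N \<noteq> {}" for N by (auto simp: patterns_def intro!: exI[of _ "\<lambda>_. 0"])
  have Efin: "finite (E i)" "E i \<noteq> {}" for i using patterns_finite_card ne by (auto simp: E_def)
  have card: "ln (card (E i)) \<le> 4 ^ i * L" for i
  proof (cases "i = 0")
    case False
    have "card (E i) \<le> (2 * n + 1) ^ 4 ^ i"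
      using False patterns_finite_card[of n "4 ^ i"] card_image_le[of "patterns n (4 ^ i)" "expert i"]
      by (simp add: E_def)
    then have "real (card (E i)) \<le> real (2 * n + 1) ^ 4 ^ i"
      by (metis of_nat_le_iff of_nat_power)
    moreover have "0 < card (E i)" using Efin by (simp add: card_gt_0_iff)
    ultimately have "ln (card (E i)) \<le> ln (real (2 * n + 1) ^ 4 ^ i)" by simp
    also have "\<dots> = 4 ^ i * L" by (simp add: L_def ln_realpow)
    finally show ?thesis .
  qed (simp add: E_def L0)
  have cover: "\<exists>g\<in>E i. \<forall>t<n. \<bar>g (take (Suc t) xs) - f (xs ! t)\<bar> \<le> 1 / 2 ^ i"
    if f: "f \<in> F" and xs: "length xs = n" "set xs \<subseteq> domX d" for i f xs
  proof -
    obtain w where w: "dot d w w \<le> 1" "f = (\<lambda>x. relu (dot d w x))" using f by (auto simp: F_def)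
    have x: "dot d (xs ! t) (xs ! t) \<le> 1" if "t < n" for t using that xs by (intro domX_dot) auto
    show ?thesis
    proof (cases "i = 0")
      case True
      have "\<bar>0 - f (xs ! t)\<bar> \<le> 1" if "t < n" for t
        using dot_abs_le[OF x[OF that] w(1)] by (auto simp: w(2) relu_def)
      then show ?thesis using True by (simp add: E_def)
    next
      case False
      have "(1 / 2 ^ i)\<^sup>2 * real (4 ^ i) = 1"
        by (simp add: power_divide square_two_power)
      then obtain p where p: "p \<in> patterns n (4 ^ i)"
        "\<And>t. t < n \<Longrightarrow> \<bar>dot d w (xs ! t) - 1 / 2 ^ i * (\<Sum>\<tau>\<le>t. p \<tau> * dot d (xs ! \<tau>) (xs ! t))\<bar> \<le> 1 / 2 ^ i"
        using perceptron_cover[where x = "\<lambda>t. xs ! t", OF x w(1), where a = "1 / 2 ^ i" and N = "4 ^ i"] by auto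
      have "\<bar>expert i p (take (Suc t) xs) - f (xs ! t)\<bar> \<le> 1 / 2 ^ i" if "t < n" for t
      proof -
        have "last (take (Suc t) xs) = xs ! t" "length (take (Suc t) xs) = Suc t"
          using that xs by (simp_all add: take_Suc_conv_app_nth)
        then have "expert i p (take (Suc t) xs) = relu (1 / 2 ^ i * (\<Sum>\<tau>\<le>t. p \<tau> * dot d (xs ! \<tau>) (xs ! t)))"
          unfolding expert_def by (simp only: lessThan_Suc_atMost) (auto intro!: arg_cong[of _ _ relu] sum.cong)
        then show ?thesis
          using p(2)[OF that] relu_lipschitz[of "1 / 2 ^ i * (\<Sum>\<tau>\<le>t. p \<tau> * dot d (xs ! \<tau>) (xs ! t))" "dot d w (xs ! t)"]
          unfolding w(2) by (simp only: abs_minus_commute[of "dot d w (xs ! t)"])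
      qed
      then show ?thesis using False p(1) by (auto simp: E_def)
    qed
  qed
  have rep: "\<exists>a f. (\<forall>j<k. \<bar>a j\<bar> \<le> 1 \<and> f j \<in> F) \<and> (\<forall>x\<in>domX d. h x = clip (\<Sum>j<k. a j * f j x))"
    if h: "h \<in> Hkd k d" for h
  proof -
    obtain a w where aw: "\<And>j. j < k \<Longrightarrow> \<bar>a j\<bar> \<le> 1" "\<And>j. j < k \<Longrightarrow> dot d (w j) (w j) \<le> 1"
      "\<And>x. h x = clip (\<Sum>j<k. a j * relu (dot d (w j) x))" using Hkd_cases[OF h] by metis
    have "\<forall>j<k. \<bar>a j\<bar> \<le> 1 \<and> (\<lambda>x. relu (dot d (w j) x)) \<in> F" using aw(1,2) by (auto simp: F_def)
    then show ?thesis using aw(3)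
      by (intro exI[of _ a] exI[of _ "\<lambda>j x. relu (dot d (w j) x)"]) auto
  qed
  \<comment> \<open>This makes the growth term equal to \<open>n * e / 8\<close>; with
    \<open>n * e / 4\<close> for the finest cover, \<open>n * e / 8\<close> of
    \<open>n * e / 2\<close> remains against the entropy term.\<close>
  define \<mu> where "\<mu> = e / (16 * real k * real M)"
  have kM: "0 < real k * real M" using k M by simp
  have \<mu>: "0 < \<mu>" using kM e by (simp add: \<mu>_def zero_less_divide_iff mult.assoc)
  have "n * e / 2 \<le> k * (n / 2 ^ M + M * (6 * L / \<mu> + 2 * real n * \<mu>))"
    by (rule shatters_chaining_bound[OF Efin _ card cover rep sh e \<mu> L]) (auto simp: E_def)
  also have "\<dots> = k * n / 2 ^ M + 6 * L * (real k * real M) / \<mu> + 2 * n * ((real k * real M) * \<mu>)"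
    by (simp add: algebra_simps)
  also have "(real k * real M) * \<mu> = e / 16" using k M by (simp add: \<mu>_def)
  also have "6 * L * (real k * real M) / \<mu> = 96 * L * (real k * real M)\<^sup>2 / e"
    using e k M by (simp add: \<mu>_def power2_eq_square)
  also have "k * n / 2 ^ M \<le> n * e / 4"
  proof -
    have "real n * (4 * real k) \<le> real n * (e * 2 ^ M)" using M(2) by (intro mult_left_mono) auto
    then show ?thesis by (simp add: field_simps)
  qed
  finally have "n * e / 2 \<le> n * e / 4 + 96 * L * (real k * real M)\<^sup>2 / e + n * e / 8"
    by (simp add: mult_ac)
  then have "n * e / 8 \<le> 96 * L * (real k * real M)\<^sup>2 / e" by linarith
  then have "n * e / 8 * e \<le> 96 * L * (real k * real M)\<^sup>2" using e by (simp add: pos_le_divide_eq)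
  then show ?thesis by (simp add: L_def power2_eq_square algebra_simps)
qed simp

section \<open>Fine scales and the final bound\<close>

text \<open>Functions in the two subtrees of a node differ there by at least \<open>e\<close> and so
  share no code; the number of codes doubles with each level.\<close>

lemma two_power_shatters_le_card:
  assumes "finite (code ` V)"
    and "\<forall>h\<in>V. \<forall>h'\<in>V. code h = code h' \<longrightarrow> (\<forall>x\<in>X. \<bar>h x - h' x\<bar> < e)"
    and "shatters X e n V"
  shows "2 ^ n \<le> card (code ` V)"
  using assms
proof (induction n arbitrary: V)
  case 0
  then show ?case by (simp add: Suc_le_eq card_gt_0_iff)
next
  case (Suc n)
  then obtain x s0 s1 where x: "x \<in> X" "s0 + e \<le> s1"
    "shatters X e n {h\<in>V. h x = s0}" "shatters X e n {h\<in>V. h x = s1}" by auto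
  let ?C = "\<lambda>s. code ` {h\<in>V. h x = s}"
  have sub: "?C s \<subseteq> code ` V" for s by auto
  have fin: "finite (?C s)" for s using finite_subset[OF sub Suc.prems(1)] .
  have ih: "2 ^ n \<le> card (?C s)" if "shatters X e n {h\<in>V. h x = s}" for s
    by (rule Suc.IH[OF fin _ that]) (use Suc.prems(2) in auto)
  have "?C s0 \<inter> ?C s1 = {}"
  proof (rule ccontr)
    assume "?C s0 \<inter> ?C s1 \<noteq> {}"
    then obtain h h' where h: "h \<in> V" "h' \<in> V" "h x = s0" "h' x = s1" "code h = code h'" by auto
    then have "\<bar>h x - h' x\<bar> < e" using Suc.prems(2) x(1) by blast
    then show False using h x(2) by simp
  qed
  then have "card (?C s0) + card (?C s1) = card (?C s0 \<union> ?C s1)"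
    using fin by (simp add: card_Un_disjoint)
  also have "\<dots> \<le> card (code ` V)" by (intro card_mono Suc.prems(1) Un_least sub)
  finally show ?case using ih[OF x(3)] ih[OF x(4)] by simp
qed

lemma floor_eq_abs_diff:
  assumes "\<lfloor>R * u\<rfloor> = \<lfloor>R * v\<rfloor>" "(0::real) < R" shows "\<bar>u - v\<bar> \<le> 1 / R"
proof -
  have "\<bar>R * u - R * v\<bar> \<le> 1" using assms(1) by linarith
  then have "R * \<bar>u - v\<bar> \<le> 1" using assms(2) by (simp add: abs_mult flip: right_diff_distrib)
  then show ?thesis using assms(2) by (simp add: field_simps)
qed

lemma floor_mult_range:
  assumes "\<bar>u\<bar> \<le> (1::real)" shows "\<lfloor>real R * u\<rfloor> \<in> {- int R..int R}"
proof -
  have "\<bar>real R * u\<bar> \<le> R" using assms by (simp add: abs_mult mult_left_le)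
  then show ?thesis by (auto simp: le_floor_iff floor_le_iff abs_le_iff)
qed

lemma clip_lipschitz: "\<bar>clip u - clip v\<bar> \<le> \<bar>u - v\<bar>"
  by (auto simp: clip_def)

text \<open>All \<open>k * (d + 1)\<close> parameters are rounded to a grid of mesh
  \<open>1 / R\<close> and the codes are counted. The bound is cruder than chaining in
  \<open>d\<close> and \<open>k\<close>, but free of logarithms and, weighted by
  \<open>e\<^sup>2\<close>, summable over the fine scales.\<close>

lemma Hkd_shatters_grid:
  assumes sh: "shatters (domX d) e n (Hkd k d)" and e: "0 < e" "e \<le> 1" and k: "1 \<le> k" and d: "1 \<le> d"
  shows "n \<le> 21 * (real d * real k)\<^sup>2 / e"
proof -
  define q where "q = real d * real k"
  have q: "1 \<le> q" using mult_mono[of 1 "real d" 1 "real k"] k d by (simp add: q_def)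
  \<comment> \<open>Rounding costs at most \<open>2 * q / R\<close> in the output, which is then
    strictly below \<open>e\<close>.\<close>
  define R where "R = nat \<lfloor>2 * q / e\<rfloor> + 1"
  have R: "2 * q / e < R" "R \<le> 2 * q / e + 1"
  proof -
    have "0 \<le> 2 * q / e" using q e by simp
    then show "2 * q / e < R" "R \<le> 2 * q / e + 1" unfolding R_def by linarith+
  qed
  have R0: "0 < real R" by (simp add: R_def)
  define P where "P h p \<longleftrightarrow> (\<forall>j<k. \<bar>fst p j\<bar> \<le> 1) \<and> (\<forall>j<k. dot d (snd p j) (snd p j) \<le> 1) \<and>
    (\<forall>x. h x = clip (\<Sum>j<k. fst p j * relu (dot d (snd p j) x)))"
    for h :: "(nat \<Rightarrow> real) \<Rightarrow> real" and p :: "(nat \<Rightarrow> real) \<times> (nat \<Rightarrow> nat \<Rightarrow> real)"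
  have "\<forall>h\<in>Hkd k d. \<exists>p. P h p"
  proof
    fix h assume "h \<in> Hkd k d"
    then show "\<exists>p. P h p"
    proof (rule Hkd_cases)
      fix a w
      assume "\<And>j. j < k \<Longrightarrow> \<bar>a j\<bar> \<le> 1" "\<And>j. j < k \<Longrightarrow> dot d (w j) (w j) \<le> 1"
        "\<And>x. h x = clip (\<Sum>j<k. a j * relu (dot d (w j) x))"
      then show ?thesis by (intro exI[of _ "(a, w)"]) (simp add: P_def)
    qed
  qed
  then obtain A where A: "\<And>h. h \<in> Hkd k d \<Longrightarrow> P h (A h)" unfolding bchoice_iff by auto
  define a where "a h = fst (A h)" for h
  define w where "w h = snd (A h)" for h
  have aw: "\<bar>a h j\<bar> \<le> 1" "dot d (w h j) (w h j) \<le> 1" "h x = clip (\<Sum>j<k. a h j * relu (dot d (w h j) x))"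
    if "h \<in> Hkd k d" "j < k" for h j x
    using A[OF that(1)] that(2) unfolding P_def a_def w_def by simp_all
  have w1: "\<bar>w h j i\<bar> \<le> 1" if "h \<in> Hkd k d" "j < k" "i < d" for h j i
  proof -
    have "w h j i * w h j i \<le> dot d (w h j) (w h j)"
      unfolding dot_def using that(3) by (intro member_le_sum) auto
    then have "(w h j i)\<^sup>2 \<le> 1" using aw(2)[OF that(1,2)] by (simp add: power2_eq_square)
    then show ?thesis by (simp add: abs_square_le_1)
  qed
  \<comment> \<open>The extra second index \<open>d\<close> encodes the output weight of unit
    \<open>j\<close>; smaller ones encode the coordinates of its weight vector.\<close>
  define I where "I = {..<k} \<times> {..d}"
  define code where "code h = (\<lambda>p\<in>I. if snd p < d then \<lfloor>R * w h (fst p) (snd p)\<rfloor> else \<lfloor>R * a h (fst p)\<rfloor>)" for h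
  have range: "code ` Hkd k d \<subseteq> (\<Pi>\<^sub>E p\<in>I. {- int R..int R})"
    using floor_mult_range w1 aw(1) by (force simp: code_def I_def)
  have finI: "finite (\<Pi>\<^sub>E p\<in>I. {- int R..int R})" by (intro finite_PiE) (auto simp: I_def)
  have close: "\<bar>h x - h' x\<bar> < e" if hh: "h \<in> Hkd k d" "h' \<in> Hkd k d" "code h = code h'" "x \<in> domX d" for h h' x
  proof -
    have c: "code h p = code h' p" for p using hh(3) by simp
    have da: "\<bar>a h j - a h' j\<bar> \<le> 1 / R" if "j < k" for j
      using c[of "(j, d)"] that R0 by (intro floor_eq_abs_diff) (auto simp: code_def I_def)
    have dw: "\<bar>w h j i - w h' j i\<bar> \<le> 1 / R" if "j < k" "i < d" for j i
      using c[of "(j, i)"] that R0 by (intro floor_eq_abs_diff) (auto simp: code_def I_def)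
    have xi: "\<bar>x i\<bar> \<le> 1" if "i < d" for i using hh(4) that by (auto simp: domX_def)
    have summand: "\<bar>a h j * relu (dot d (w h j) x) - a h' j * relu (dot d (w h' j) x)\<bar> \<le> (real d + 1) / R" if j: "j < k" for j
    proof -
      define u v where "u = relu (dot d (w h j) x)" and "v = relu (dot d (w h' j) x)"
      have u: "\<bar>u\<bar> \<le> 1"
        using dot_abs_le[OF domX_dot[OF hh(4)] aw(2)[OF hh(1) j]] by (auto simp: u_def relu_def)
      have "\<bar>u - v\<bar> \<le> \<bar>dot d (w h j) x - dot d (w h' j) x\<bar>" unfolding u_def v_def by (rule relu_lipschitz)
      also have "\<dots> = \<bar>\<Sum>i<d. (w h j i - w h' j i) * x i\<bar>"
        by (simp add: dot_def left_diff_distrib sum_subtractf)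
      also have "\<dots> \<le> (\<Sum>i<d. 1 / R * 1)"
      proof (rule order_trans[OF sum_abs sum_mono])
        fix i assume "i \<in> {..<d}"
        then show "\<bar>(w h j i - w h' j i) * x i\<bar> \<le> 1 / R * 1"
          unfolding abs_mult using dw[OF j] xi R0 by (intro mult_mono) auto
      qed
      finally have uv: "\<bar>u - v\<bar> \<le> d / R" by simp
      have "a h j * u - a h' j * v = (a h j - a h' j) * u + a h' j * (u - v)" by (simp add: algebra_simps)
      then have "\<bar>a h j * u - a h' j * v\<bar> \<le> \<bar>a h j - a h' j\<bar> * \<bar>u\<bar> + \<bar>a h' j\<bar> * \<bar>u - v\<bar>"
        by (metis abs_mult abs_triangle_ineq)
      also have "\<dots> \<le> 1 / R * 1 + 1 * (d / R)"
        using da[OF j] u uv aw(1)[OF hh(2) j] R0 by (intro add_mono mult_mono) auto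
      finally show ?thesis by (simp add: u_def v_def add_divide_distrib)
    qed
    have "\<bar>h x - h' x\<bar> \<le> \<bar>(\<Sum>j<k. a h j * relu (dot d (w h j) x)) - (\<Sum>j<k. a h' j * relu (dot d (w h' j) x))\<bar>"
    proof -
      have "0 < k" using k by simp
      from aw(3)[OF hh(1) this, of x] aw(3)[OF hh(2) this, of x] show ?thesis
        by (simp only: clip_lipschitz)
    qed
    also have "\<dots> \<le> (\<Sum>j<k. (real d + 1) / R)"
      unfolding sum_subtractf[symmetric] by (rule order_trans[OF sum_abs sum_mono]) (use summand in auto)
    also have "\<dots> \<le> 2 * q / R"
    proof -
      have "real k * (real d + 1) \<le> real k * (2 * real d)" using d by (intro mult_left_mono) auto
      then show ?thesis by (simp add: q_def divide_right_mono mult_ac)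
    qed
    also have "\<dots> < e" using R(1) R0 e(1) by (simp add: field_simps)
    finally show ?thesis .
  qed
  have "2 ^ n \<le> card (code ` Hkd k d)"
    by (rule two_power_shatters_le_card[OF finite_subset[OF range finI] _ sh]) (use close in blast)
  also have "\<dots> \<le> card (\<Pi>\<^sub>E p\<in>I. {- int R..int R})" by (rule card_mono[OF finI range])
  also have "\<dots> = (2 * R + 1) ^ (k * (d + 1))"
  proof -
    have "card {- int R..int R} = 2 * R + 1" by simp
    then show ?thesis
      by (subst card_PiE) (simp_all only: prod_constant, auto simp: I_def card_cartesian_product)
  qed
  finally have "(2::real) ^ n \<le> real (2 * R + 1) ^ (k * (d + 1))"
    by (metis of_nat_le_iff of_nat_power of_nat_numeral)
  then have "ln ((2::real) ^ n) \<le> ln (real (2 * R + 1) ^ (k * (d + 1)))" by (simp del: of_nat_add of_nat_mult)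
  then have "n * ln 2 \<le> (real k * (real d + 1)) * ln (real (2 * R + 1))"
    by (simp add: ln_realpow algebra_simps)
  also have "\<dots> \<le> (2 * q) * (7 * q / e)"
  proof (rule mult_mono)
    have "real k * (real d + 1) \<le> real k * (2 * real d)" using d by (intro mult_left_mono) auto
    then show "real k * (real d + 1) \<le> 2 * q" by (simp add: q_def mult_ac)
    \<comment> \<open>Bounding the logarithm linearly costs a factor of order \<open>1 / e\<close>,
      affordable under the weight \<open>e\<^sup>2\<close>.\<close>
    have "ln (real (2 * R + 1)) \<le> real (2 * R + 1)" using ln_le_minus_one[of "real (2 * R + 1)"] by simp
    also have "\<dots> \<le> 4 * q / e + 3" using R(2) by simp
    also have "3 \<le> 3 * q / e" using q e by (simp add: field_simps)
    finally show "ln (real (2 * R + 1)) \<le> 7 * q / e" by (simp add: field_simps)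
  qed (use q in auto)
  finally have "n * ln 2 \<le> 14 * q\<^sup>2 / e" by (simp add: power2_eq_square)
  moreover have "n * (2 / 3) \<le> n * ln 2" using ln2_ge_two_thirds by (intro mult_left_mono) auto
  ultimately show ?thesis by (simp add: q_def)
qed

section \<open>Summation over the scales\<close>

lemma dyadic_upper:
  assumes "1 \<le> (q::real)" shows "\<exists>r::nat. q \<le> 2 ^ r \<and> r \<le> 2 * (1 + ln q)"
proof -
  define r where "r = nat \<lceil>log 2 q\<rceil>"
  have l0: "0 \<le> log 2 q" "0 \<le> ln q" using assms by simp_all
  have "log 2 q \<le> r" unfolding r_def by linarith
  then have "2 powr log 2 q \<le> 2 powr r" by simp
  then have "q \<le> 2 ^ r" using assms by (simp add: powr_realpow)
  moreover have "r \<le> 2 * (1 + ln q)"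
  proof -
    have "real r \<le> log 2 q + 1" using l0 unfolding r_def by linarith
    moreover have "log 2 q \<le> ln q / (1 / 2)"
      unfolding log_def using ln2_ge_two_thirds l0 by (intro divide_left_mono) auto
    ultimately show ?thesis by simp
  qed
  ultimately show ?thesis by blast
qed

text \<open>The four logarithmic factors are one for the number of coarse scales, two for the
  squared chain length and one for the cover entropy.\<close>

lemma Hkd_learner:
  assumes k: "1 \<le> k" and d: "1 \<le> d"
  shows "\<exists>L. \<forall>zs. realizable_seq (Hkd k d) (domX d) zs \<longrightarrow>
    cum_sq_loss L zs \<le> 4 * (42 + 4 * 768 * 64 * 14) * (real k)\<^sup>2 * (ln (exp 1 * real d * real k)) ^ 4"
proof -
  define q where "q = real d * real k"
  have q: "1 \<le> q" using mult_mono[of 1 "real d" 1 "real k"] k d by (simp add: q_def)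
  define lg where "lg = ln (exp 1 * real d * real k)"
  have lg: "lg = 1 + ln q" using q k d by (simp add: lg_def q_def ln_mult)
  have l1: "1 \<le> lg" using q lg by simp
  obtain r :: nat where r: "q \<le> 2 ^ r" "r \<le> 2 * lg" using dyadic_upper[OF q] lg by auto
  have q2: "q\<^sup>2 \<le> 4 ^ r"
  proof -
    have "q\<^sup>2 \<le> (2 ^ r)\<^sup>2" using r(1) q by (intro power_mono) auto
    then show ?thesis by (simp add: square_two_power)
  qed
  define c where "c = 768 * (real k)\<^sup>2 * (3 * real r + 2)\<^sup>2 * (4 * real r + 6)"
  \<comment> \<open>From \<open>i = 2 * r\<close> on, the grid bound is a geometric tail whose sum
    is at most 42, since \<open>q\<^sup>2 \<le> 4 ^ r\<close>.\<close>
  define G where "G i = (if i < 2 * r then c else 21 * q\<^sup>2 / 2 ^ i)" for i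
  have dim: "real n / 4 ^ i \<le> G i" if sh: "shatters (domX d) (1 / 2 ^ i) n (Hkd k d)" for i n
  proof -
    have n: "real n \<le> 21 * q\<^sup>2 * 2 ^ i" using Hkd_shatters_grid[OF sh _ _ k d] by (simp add: q_def)
    have four: "(4::real) ^ i = 2 ^ i * 2 ^ i" by (simp flip: power_mult_distrib)
    show ?thesis
    proof (cases "i < 2 * r")
      case False
      have "real n / 4 ^ i \<le> 21 * q\<^sup>2 * 2 ^ i / 4 ^ i" using n by (intro divide_right_mono) auto
      then show ?thesis using False by (simp add: G_def four)
    next
      case True
      then have i: "i \<le> 2 * r" by simp
      have "real k \<le> q" using d k by (simp add: q_def)
      \<comment> \<open>Chain length \<open>3 * r + 2\<close>: \<open>2 * r\<close> compensates the
        scale \<open>1 / 2 ^ i\<close>, and \<open>r + 2\<close> accounts for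
        \<open>4 * k\<close>.\<close>
      then have "4 * real k \<le> 4 * 2 ^ r" using r(1) by linarith
      also have "\<dots> = 1 / 2 ^ i * (2 ^ i * (4 * 2 ^ r))" by simp
      also have "\<dots> \<le> 1 / 2 ^ i * (2 ^ (2 * r) * (4 * 2 ^ r))"
        using i by (intro mult_left_mono mult_right_mono power_increasing) auto
      also have "\<dots> = 1 / 2 ^ i * 2 ^ (3 * r + 2)" by (simp add: power_add[symmetric] numeral_eq_Suc)
      finally have M: "4 * real k \<le> 1 / 2 ^ i * 2 ^ (3 * r + 2)" .
      have ch: "n * (1 / 2 ^ i)\<^sup>2 \<le> 768 * (real k)\<^sup>2 * (real (3 * r + 2))\<^sup>2 * ln (2 * real n + 1)"
        by (rule Hkd_shatters_chaining[OF sh _ k _ M]) auto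
      \<comment> \<open>The grid bound removes \<open>n\<close> from the logarithm; 2 * 21 + 1 is at
        most 64 = 2^6, whence \<open>4 * r + 6\<close>.\<close>
      have "21 * q\<^sup>2 * 2 ^ i \<le> 21 * 4 ^ r * 2 ^ (2 * r)"
        using q2 i by (intro mult_mono power_increasing) auto
      then have n': "real n \<le> 21 * 16 ^ r" using n by (simp add: power_mult power_mult_distrib[symmetric])
      have "(1::real) \<le> 16 ^ r" by simp
      then have "2 * real n + 1 \<le> 64 * 16 ^ r" using n' by linarith
      then have "ln (2 * real n + 1) \<le> ln (64 * 16 ^ r)" by simp
      also have "(64::real) * 16 ^ r = 2 ^ (4 * r + 6)" by (simp add: power_add power_mult)
      also have "ln ((2::real) ^ (4 * r + 6)) = real (4 * r + 6) * ln 2" by (rule ln_realpow)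
      also have "\<dots> \<le> real (4 * r + 6) * 1" using ln_2_less_1 by (intro mult_left_mono) auto
      finally have "ln (2 * real n + 1) \<le> 4 * real r + 6" by simp
      then have "768 * (real k)\<^sup>2 * (real (3 * r + 2))\<^sup>2 * ln (2 * real n + 1)
          \<le> 768 * (real k)\<^sup>2 * (real (3 * r + 2))\<^sup>2 * (4 * real r + 6)"
        by (intro mult_left_mono) auto
      from order_trans[OF ch this] have "n * (1 / 2 ^ i)\<^sup>2 \<le> c" by (simp add: c_def add.commute)
      then show ?thesis using True by (simp add: G_def four power2_eq_square)
    qed
  qed
  have "(\<lambda>i. 21 * q\<^sup>2 / 4 ^ r * (1 / 2) ^ i) sums (21 * q\<^sup>2 / 4 ^ r * 2)"
    using geometric_sums[of "1 / 2 :: real"] by (intro sums_mult) simp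
  moreover have "G (i + 2 * r) = 21 * q\<^sup>2 / 4 ^ r * (1 / 2) ^ i" for i
    by (simp add: G_def power_add power_mult power_one_over)
  ultimately have "(\<lambda>i. G (i + 2 * r)) sums (21 * q\<^sup>2 / 4 ^ r * 2)" by simp
  then have "G sums (21 * q\<^sup>2 / 4 ^ r * 2 + (\<Sum>i<2 * r. G i))" by (simp only: sums_iff_shift)
  moreover have "(\<Sum>i<2 * r. G i) = 2 * real r * c" by (simp add: G_def)
  ultimately have sums: "G sums (21 * q\<^sup>2 / 4 ^ r * 2 + 2 * real r * c)" by simp
  have G0: "0 \<le> G i" for i by (simp add: G_def c_def)
  have bnd: "\<bar>h x\<bar> \<le> 1" if "h \<in> Hkd k d" for h x using that abs_clip_le by (auto simp: Hkd_def)
  have "\<exists>L. \<forall>zs. realizable_seq (Hkd k d) (domX d) zs \<longrightarrow> cum_sq_loss L zs \<le> 4 * suminf G"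
    by (rule learner_from_dimensions) (use bnd dim sums_summable[OF sums] G0 in auto)
  moreover have "4 * suminf G \<le> 4 * (42 + 4 * 768 * 64 * 14) * (real k)\<^sup>2 * lg ^ 4"
  proof -
    have "21 * q\<^sup>2 / 4 ^ r * 2 \<le> 42 * 1" using q2 by (simp add: divide_le_eq)
    also have "\<dots> \<le> 42 * ((real k)\<^sup>2 * lg ^ 4)"
      using mult_mono[of 1 "(real k)\<^sup>2" 1 "lg ^ 4"] k l1 by (simp add: one_le_power)
    finally have 1: "21 * q\<^sup>2 / 4 ^ r * 2 \<le> 42 * ((real k)\<^sup>2 * lg ^ 4)" .
    \<comment> \<open>The additive constants are absorbed using \<open>lg \<ge> 1\<close>.\<close>
    have b: "2 * real r \<le> 4 * lg" "3 * real r + 2 \<le> 8 * lg" "4 * real r + 6 \<le> 14 * lg"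
      using r(2) l1 by linarith+
    have "c \<le> 768 * (real k)\<^sup>2 * (8 * lg)\<^sup>2 * (14 * lg)"
      unfolding c_def by (rule mult_mono[OF mult_left_mono[OF power_mono[OF b(2)]] b(3)]) auto
    then have "2 * real r * c \<le> (4 * lg) * (768 * (real k)\<^sup>2 * (8 * lg)\<^sup>2 * (14 * lg))"
      using b(1) l1 by - (rule mult_mono, auto simp: c_def)
    also have "\<dots> = 4 * 768 * 64 * 14 * ((real k)\<^sup>2 * lg ^ 4)" by (simp add: power2_eq_square power4_eq_xxxx)
    finally have "suminf G \<le> 42 * ((real k)\<^sup>2 * lg ^ 4) + 4 * 768 * 64 * 14 * ((real k)\<^sup>2 * lg ^ 4)"
      unfolding sums_unique[OF sums, symmetric] using 1 by (intro add_mono)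
    then show ?thesis by (simp add: mult_ac)
  qed
  ultimately show ?thesis unfolding lg_def by (meson order_trans)
qed

theorem theorem1p6:
  shows "\<exists>C::real. \<forall>d k::nat. d \<ge> 1 \<longrightarrow> k \<ge> 1 \<longrightarrow>
     D_onl (Hkd k d) (domX d) \<le> ennreal (C * real k ^ 2 * (ln (exp 1 * real d * real k)) ^ 4) \<and>
     (\<exists>L. \<forall>zs. realizable_seq (Hkd k d) (domX d) zs \<longrightarrow>
        cum_sq_loss L zs \<le> C * real k ^ 2 * (ln (exp 1 * real d * real k)) ^ 4)"
  using Hkd_learner D_onl_le_learner_loss by metis

end
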